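(* Let $K$ be a field, let $G$ be a finite simple graph and $I=I(G)$ its edge ideal over $K$. Then $$\beta_{i,j}(R(I))\ge\beta_{i,j}(K[G])\quad\text{for all } i\text{ and } j.$$ In particular, $\operatorname{reg}R(I)\ge\operatorname{reg}K[G]$.
   Context: Let $G$ be a finite simple graph with $V(G)=[n]=\{1,\dots,n\}$ and edge set $E(G)$, and let $S=K[x_1,\dots,x_n]$ be the polynomial ring over a field $K$. The edge ideal $I(G)\subset S$ is the ideal generated by the monomials $x_ix_j$ with $\{i,j\}\in E(G)$. The edge ring $K[G]$ is the $K$-subalgebra of $S$ generated by the monomials $x_ix_j$ with $\{i,j\}\in E(G)$, standard graded so that each such monomial has degree $1$. The Rees algebra of an ideal $I$ is $R(I)=\bigoplus_{s\ge 0}I^s$. $G^*$ denotes the graph with $V(G^* )=[n+1]$ and $E(G^* )=E(G)\cup\{\{i,n+1\}: i\in V(G)\}$. The Rees algebra $R(I(G))$ is identified with the edge ring $K[G^*]$, the monomial $x_ix_{n+1}$ corresponding to $x_i\in S$ (in Rees degree $0$) and $x_ix_j$, for $\{i,j\}\in E(G)$, corresponding to the generator $x_ix_j\in I(G)$ (in Rees degree $1$). Through this identification $R(I(G))$ is a standard graded $K$-algebra, each of the $n+|E(G)|$ monomial generators having degree $1$. For a standard graded toric $K$-algebra $A$ minimally generated by monomials $u_1,\dots,u_m$, let $P=K[t_1,\dots,t_m]$ be the standard graded polynomial ring, mapping onto $A$ by $t_k\mapsto u_k$; put $\beta_{i,j}(A)=\dim_K\operatorname{Tor}_i^P(A,K)_j$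 and $\operatorname{reg}A=\max\{j-i:\beta_{i,j}(A)\ne 0\}$ (Castelnuovo–Mumford regularity). *)

theory Defs
  imports
    "HOL-Library.Poly_Mapping"
    "HOL-Library.Extended_Real"
    "HOL-Computational_Algebra.Polynomial"
begin

text \<open>
  Polynomials over \<open>'k\<close> in variables of type \<open>'v\<close>: finitely supported functions on the monoid of
  monomials \<open>'v \<Rightarrow>\<^sub>0 nat\<close>, with the convolution product.
\<close>

type_synonym ('v, 'k) mpoly = "('v \<Rightarrow>\<^sub>0 nat) \<Rightarrow>\<^sub>0 'k"

definition mconst :: "'k::comm_ring_1 \<Rightarrow> ('v, 'k) mpoly" where
  "mconst c = Poly_Mapping.single 0 c"

definition mvar :: "'v \<Rightarrow> ('v, 'k::comm_ring_1) mpoly" where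
  "mvar v = Poly_Mapping.single (Poly_Mapping.single v 1) 1"

definition mdeg :: "('v \<Rightarrow>\<^sub>0 nat) \<Rightarrow> nat" where
  "mdeg m = (\<Sum>v\<in>Poly_Mapping.keys m. Poly_Mapping.lookup m v)"

definition mpolys :: "'v set \<Rightarrow> ('v, 'k::comm_ring_1) mpoly set" where
  "mpolys V = {p. \<forall>m\<in>Poly_Mapping.keys p. Poly_Mapping.keys m \<subseteq> V}"

definition hom_mpolys :: "'v set \<Rightarrow> int \<Rightarrow> ('v, 'k::comm_ring_1) mpoly set" where
  "hom_mpolys V j = {p \<in> mpolys V. \<forall>m\<in>Poly_Mapping.keys p. int (mdeg m) = j}"

text \<open>
  A \<open>K\<close>-algebra is given by a commutative ring \<open>'r\<close> with structure map \<open>\<iota> :: 'k \<Rightarrow> 'r\<close>.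
  For a finite set \<open>U\<close> of elements of \<open>'r\<close>, the polynomial ring \<open>P = K[t\<^sub>u : u \<in> U]\<close> has its
  variables indexed by the elements of \<open>U\<close> themselves, and \<open>toric_map \<iota>\<close> is the \<open>K\<close>-algebra
  homomorphism sending \<open>t\<^sub>u\<close> to \<open>u\<close>.
\<close>

definition subalgebra :: "('k \<Rightarrow> 'r::comm_ring_1) \<Rightarrow> 'r set \<Rightarrow> bool" where
  "subalgebra \<iota> A \<longleftrightarrow> range \<iota> \<subseteq> A \<and> (\<forall>a\<in>A. \<forall>b\<in>A. a + b \<in> A \<and> a * b \<in> A)"

definition toric_map :: "('k::field \<Rightarrow> 'r::comm_ring_1) \<Rightarrow> ('r, 'k) mpoly \<Rightarrow> 'r" where
  "toric_map \<iota> p =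
     (\<Sum>m\<in>Poly_Mapping.keys p. \<iota> (Poly_Mapping.lookup p m) *
        (\<Prod>u\<in>Poly_Mapping.keys m. u ^ Poly_Mapping.lookup m u))"

text \<open>Degree \<open>j\<close> component of \<open>K[U]\<close> in the standard grading, where every \<open>u \<in> U\<close> has degree 1.\<close>

definition alg_component :: "('k::field \<Rightarrow> 'r::comm_ring_1) \<Rightarrow> 'r set \<Rightarrow> int \<Rightarrow> 'r set" where
  "alg_component \<iota> U j = toric_map \<iota> ` hom_mpolys U j"

text \<open>
  The graded free module \<open>\<Oplus>\<^bsub>b\<in>B\<^esub> P(-d b)\<close> over \<open>P = K[V]\<close>, with basis element \<open>b\<close> in degree \<open>d b\<close>.
\<close>

definition free_mod :: "'v set \<Rightarrow> 'b set \<Rightarrow> ('b \<Rightarrow>\<^sub>0 ('v, 'k::comm_ring_1) mpoly) set" where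
  "free_mod V B =
     {f. Poly_Mapping.keys f \<subseteq> B \<and> (\<forall>b. Poly_Mapping.lookup f b \<in> mpolys V)}"

definition free_component ::
    "'v set \<Rightarrow> 'b set \<Rightarrow> ('b \<Rightarrow> int) \<Rightarrow> int \<Rightarrow> ('b \<Rightarrow>\<^sub>0 ('v, 'k::comm_ring_1) mpoly) set" where
  "free_component V B d j =
     {f \<in> free_mod V B. \<forall>b. Poly_Mapping.lookup f b \<in> hom_mpolys V (j - d b)}"

definition smul :: "'a::comm_ring_1 \<Rightarrow> ('b \<Rightarrow>\<^sub>0 'a) \<Rightarrow> ('b \<Rightarrow>\<^sub>0 'a)" where
  "smul a f = Poly_Mapping.map (\<lambda>x. a * x) f"

text \<open>
  A graded free resolution
  \<open>\<dots> \<rightarrow> F\<^sub>2 \<rightarrow> F\<^sub>1 \<rightarrow> F\<^sub>0 \<rightarrow> A \<rightarrow> 0\<close> of \<open>A = K[U]\<close> over \<open>P = K[t\<^sub>u : u \<in> U]\<close>: the module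
  \<open>F\<^sub>i\<close> is free on \<open>B i\<close> with degrees \<open>d i\<close>, the differential \<open>F\<^bsub>i+1\<^esub> \<rightarrow> F\<^sub>i\<close> is
  \<open>D i\<close>, and the augmentation \<open>F\<^sub>0 \<rightarrow> A\<close> is \<open>e\<close>; all maps are \<open>P\<close>-linear of degree 0.  Each
  \<open>F\<^sub>i\<close> is required to have finitely many basis elements in each degree, so that the
  graded pieces of \<open>F\<^sub>i \<otimes>\<^sub>P K\<close> are finite-dimensional; finitely generated free modules are included.
\<close>

definition graded_free_resolution ::
    "('k::field \<Rightarrow> 'r::comm_ring_1) \<Rightarrow> 'r set \<Rightarrow> 'r set \<Rightarrow>
     (nat \<Rightarrow> nat set) \<Rightarrow> (nat \<Rightarrow> nat \<Rightarrow> int) \<Rightarrow>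
     (nat \<Rightarrow> (nat \<Rightarrow>\<^sub>0 ('r, 'k) mpoly) \<Rightarrow> (nat \<Rightarrow>\<^sub>0 ('r, 'k) mpoly)) \<Rightarrow>
     ((nat \<Rightarrow>\<^sub>0 ('r, 'k) mpoly) \<Rightarrow> 'r) \<Rightarrow> bool" where
  "graded_free_resolution \<iota> U A B d D e \<longleftrightarrow>
     (\<forall>i j. finite {b \<in> B i. d i b = j}) \<and>
     (\<forall>i. \<forall>f\<in>free_mod U (B (Suc i)). \<forall>g\<in>free_mod U (B (Suc i)). D i (f + g) = D i f + D i g) \<and>
     (\<forall>i. \<forall>p\<in>mpolys U. \<forall>f\<in>free_mod U (B (Suc i)). D i (smul p f) = smul p (D i f)) \<and>
     (\<forall>i j. D i ` free_component U (B (Suc i)) (d (Suc i)) j \<subseteq> free_component U (B i) (d i) j) \<and>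
     (\<forall>f\<in>free_mod U (B 0). \<forall>g\<in>free_mod U (B 0). e (f + g) = e f + e g) \<and>
     (\<forall>p\<in>mpolys U. \<forall>f\<in>free_mod U (B 0). e (smul p f) = toric_map \<iota> p * e f) \<and>
     (\<forall>j. e ` free_component U (B 0) (d 0) j \<subseteq> alg_component \<iota> U j) \<and>
     e ` free_mod U (B 0) = A \<and>
     {f \<in> free_mod U (B 0). e f = 0} = D 0 ` free_mod U (B 1) \<and>
     (\<forall>i. {f \<in> free_mod U (B (Suc i)). D i f = 0} = D (Suc i) ` free_mod U (B (Suc (Suc i))))"

text \<open>
  Tensoring with \<open>K = P/(t\<^sub>u : u \<in> U)\<close>: the degree \<open>j\<close> part of \<open>F\<^sub>i \<otimes>\<^sub>P K\<close> is the \<open>K\<close>-space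
  on the basis elements of degree \<open>j\<close>, and \<open>D \<otimes> K\<close> is obtained by applying \<open>D\<close> and
  taking constant coefficients.
\<close>

definition tensor_component :: "'b set \<Rightarrow> ('b \<Rightarrow> int) \<Rightarrow> int \<Rightarrow> ('b \<Rightarrow>\<^sub>0 'k::field) set" where
  "tensor_component B d j = {v. Poly_Mapping.keys v \<subseteq> {b \<in> B. d b = j}}"

definition tensor_map ::
    "(('b \<Rightarrow>\<^sub>0 ('v, 'k::field) mpoly) \<Rightarrow> ('c \<Rightarrow>\<^sub>0 ('v, 'k) mpoly)) \<Rightarrow>
     ('b \<Rightarrow>\<^sub>0 'k) \<Rightarrow> ('c \<Rightarrow>\<^sub>0 'k)" where
  "tensor_map D v =
     Poly_Mapping.map (\<lambda>p. Poly_Mapping.lookup p 0) (D (Poly_Mapping.map mconst v))"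

definition tor_cycles ::
    "(nat \<Rightarrow> nat set) \<Rightarrow> (nat \<Rightarrow> nat \<Rightarrow> int) \<Rightarrow>
     (nat \<Rightarrow> (nat \<Rightarrow>\<^sub>0 ('v, 'k::field) mpoly) \<Rightarrow> (nat \<Rightarrow>\<^sub>0 ('v, 'k) mpoly)) \<Rightarrow>
     nat \<Rightarrow> int \<Rightarrow> (nat \<Rightarrow>\<^sub>0 'k) set" where
  "tor_cycles B d D i j =
     {v \<in> tensor_component (B i) (d i) j.
        case i of 0 \<Rightarrow> True | Suc k \<Rightarrow> tensor_map (D k) v = 0}"

definition tor_boundaries ::
    "(nat \<Rightarrow> nat set) \<Rightarrow> (nat \<Rightarrow> nat \<Rightarrow> int) \<Rightarrow>
     (nat \<Rightarrow> (nat \<Rightarrow>\<^sub>0 ('v, 'k::field) mpoly) \<Rightarrow> (nat \<Rightarrow>\<^sub>0 ('v, 'k) mpoly)) \<Rightarrow>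
     nat \<Rightarrow> int \<Rightarrow> (nat \<Rightarrow>\<^sub>0 'k) set" where
  "tor_boundaries B d D i j =
     tensor_map (D i) ` tensor_component (B (Suc i)) (d (Suc i)) j"

definition kdim :: "('b \<Rightarrow>\<^sub>0 'k::field) set \<Rightarrow> nat" where
  "kdim W = vector_space.dim smul W"

definition tor_dim ::
    "(nat \<Rightarrow> nat set) \<Rightarrow> (nat \<Rightarrow> nat \<Rightarrow> int) \<Rightarrow>
     (nat \<Rightarrow> (nat \<Rightarrow>\<^sub>0 ('v, 'k::field) mpoly) \<Rightarrow> (nat \<Rightarrow>\<^sub>0 ('v, 'k) mpoly)) \<Rightarrow>
     nat \<Rightarrow> int \<Rightarrow> nat" where
  "tor_dim B d D i j = kdim (tor_cycles B d D i j) - kdim (tor_boundaries B d D i j)"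

text \<open>
  \<open>betti \<iota> U A i j = dim\<^sub>K Tor\<^sub>i\<^sup>P(A, K)\<^sub>j\<close> for \<open>A = K[U]\<close>.  As usual for \<open>Tor\<close>, it is computed
  from any graded free resolution of \<open>A\<close> over \<open>P\<close>; the value does not depend on the choice.
\<close>

definition betti ::
    "('k::field \<Rightarrow> 'r::comm_ring_1) \<Rightarrow> 'r set \<Rightarrow> 'r set \<Rightarrow> nat \<Rightarrow> int \<Rightarrow> nat" where
  "betti \<iota> U A i j =
     (SOME \<beta>. \<exists>B d D e. graded_free_resolution \<iota> U A B d D e \<and> \<beta> = tor_dim B d D i j)"

text \<open>
  The supremum is taken in the extended reals; it is a maximum, since a finitely generated
  graded module over a polynomial ring has only finitely many nonzero graded Betti numbers.
\<close>

definition regularity :: "('k::field \<Rightarrow> 'r::comm_ring_1) \<Rightarrow> 'r set \<Rightarrow> 'r set \<Rightarrow> ereal" where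
  "regularity \<iota> U A =
     Sup {ereal (real_of_int (j - int i)) | i j. betti \<iota> U A i j \<noteq> 0}"

definition simple_graph :: "nat \<Rightarrow> nat set set \<Rightarrow> bool" where
  "simple_graph n E \<longleftrightarrow> (\<forall>e\<in>E. e \<subseteq> {1..n} \<and> card e = 2)"

definition edge_monomials :: "nat set set \<Rightarrow> (nat, 'k::field) mpoly set" where
  "edge_monomials E = {mvar i * mvar j | i j. {i, j} \<in> E}"

definition edge_ring :: "nat set set \<Rightarrow> (nat, 'k::field) mpoly set" where
  "edge_ring E = subalgebra mconst hull edge_monomials E"

definition ideal_of :: "'r::comm_ring_1 set \<Rightarrow> 'r set \<Rightarrow> bool" where
  "ideal_of S I \<longleftrightarrow>
     I \<subseteq> S \<and> 0 \<in> I \<and> (\<forall>a\<in>I. \<forall>b\<in>I. a + b \<in> I) \<and> (\<forall>s\<in>S. \<forall>a\<in>I. s * a \<in> I)"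

fun ideal_power :: "'r::comm_ring_1 set \<Rightarrow> 'r set \<Rightarrow> nat \<Rightarrow> 'r set" where
  "ideal_power S I 0 = S"
| "ideal_power S I (Suc s) = ideal_of S hull {a * b | a b. a \<in> I \<and> b \<in> ideal_power S I s}"

definition edge_ideal :: "nat \<Rightarrow> nat set set \<Rightarrow> (nat, 'k::field) mpoly set" where
  "edge_ideal n E = ideal_of (mpolys {1..n}) hull edge_monomials E"

text \<open>
  The Rees algebra \<open>\<Oplus>\<^sub>s I\<^sup>s\<close> of an ideal \<open>I\<close> of \<open>S\<close> is realised as the subring
  \<open>\<Oplus>\<^sub>s I\<^sup>s T\<^sup>s\<close> of \<open>S[T]\<close>; the outer type \<open>poly\<close> carries the variable \<open>T\<close>.
\<close>

definition rees_algebra :: "'r::comm_ring_1 set \<Rightarrow> 'r set \<Rightarrow> 'r poly set" where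
  "rees_algebra S I = {f. \<forall>s. coeff f s \<in> ideal_power S I s}"

definition rees_const :: "'k::field \<Rightarrow> (nat, 'k) mpoly poly" where
  "rees_const c = [:mconst c:]"

text \<open>
  The algebra generators \<open>x\<^sub>i\<close> (Rees degree 0) and \<open>x\<^sub>i x\<^sub>j T\<close> (Rees degree 1) of the Rees algebra of
  an edge ideal.  Giving all of them degree 1 is the standard grading obtained from
  the identification with the edge ring of the cone over the graph,
  \<open>x\<^sub>i \<leftrightarrow> x\<^sub>i x\<^bsub>n+1\<^esub>\<close> and \<open>x\<^sub>i x\<^sub>j T \<leftrightarrow> x\<^sub>i x\<^sub>j\<close>.
\<close>

definition rees_generators :: "nat \<Rightarrow> nat set set \<Rightarrow> (nat, 'k::field) mpoly poly set" where
  "rees_generators n E =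
     (\<lambda>i. [:mvar i:]) ` {1..n} \<union> (\<lambda>m. monom m 1) ` edge_monomials E"

definition betti_edge_ring :: "'k::field itself \<Rightarrow> nat set set \<Rightarrow> nat \<Rightarrow> int \<Rightarrow> nat" where
  "betti_edge_ring K E =
     betti (mconst :: 'k \<Rightarrow> (nat, 'k) mpoly) (edge_monomials E) (edge_ring E)"

definition reg_edge_ring :: "'k::field itself \<Rightarrow> nat set set \<Rightarrow> ereal" where
  "reg_edge_ring K E =
     regularity (mconst :: 'k \<Rightarrow> (nat, 'k) mpoly) (edge_monomials E) (edge_ring E)"

definition betti_rees :: "'k::field itself \<Rightarrow> nat \<Rightarrow> nat set set \<Rightarrow> nat \<Rightarrow> int \<Rightarrow> nat" where
  "betti_rees K n E =
     betti (rees_const :: 'k \<Rightarrow> (nat, 'k) mpoly poly) (rees_generators n E)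
       (rees_algebra (mpolys {1..n}) (edge_ideal n E))"

definition reg_rees :: "'k::field itself \<Rightarrow> nat \<Rightarrow> nat set set \<Rightarrow> ereal" where
  "reg_rees K n E =
     regularity (rees_const :: 'k \<Rightarrow> (nat, 'k) mpoly poly) (rees_generators n E)
       (rees_algebra (mpolys {1..n}) (edge_ideal n E))"

end

theory Submission imports Defs begin

text \<open>
  The edge ring \<open>K[G]\<close> is an algebra retract of the Rees algebra \<open>R(I)\<close>.  The inclusion sends the
  generator \<open>x\<^sub>i x\<^sub>j\<close> to \<open>x\<^sub>i x\<^sub>j T\<close>; the retraction sends \<open>x\<^sub>i x\<^sub>j T\<close> back to \<open>x\<^sub>i x\<^sub>j\<close> and kills the generators
  \<open>x\<^sub>i\<close> of Rees degree \<open>0\<close>.  It is well defined because a monomial \<open>x\<^sup>c T\<^sup>s\<close> of \<open>R(I)\<close> has \<open>|c| \<ge> 2 s\<close>, with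
  equality exactly when it is a product of generators \<open>x\<^sub>i x\<^sub>j T\<close> only.  Both maps preserve the standard
  grading and lift to graded homomorphisms \<open>\<eta>\<close> and \<open>\<rho>\<close> between the polynomial rings \<open>P'\<close> and \<open>P\<close>
  presenting \<open>K[G]\<close> and \<open>R(I)\<close>: \<open>\<eta>\<close> renames variables, \<open>\<rho>\<close> undoes the renaming and sends the variables of
  the \<open>x\<^sub>i\<close> to \<open>0\<close>, so that \<open>\<rho> \<circ> \<eta> = id\<close>.

  Betti numbers can only go down under a retract, since \<open>Tor\<close> is functorial in the pair of rings.
  Let \<open>F'\<close> and \<open>F\<close> be graded free resolutions of \<open>K[G]\<close> and \<open>R(I)\<close>.  The comparison theorem
  (\<open>comparison\<close>), in a version semilinear over a graded homomorphism of polynomial rings, lifts the two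
  algebra maps to chain maps \<open>F' \<rightarrow> F \<rightarrow> F'\<close>.  The composite is \<open>P'\<close>-linear and lifts the identity of
  \<open>K[G]\<close>, so it is homotopic to the identity (\<open>null_homotopy\<close>).  After tensoring with \<open>K\<close>, the identity of
  \<open>Tor\<^sub>i(K[G], K)\<^sub>j\<close> factors through \<open>Tor\<^sub>i(R(I), K)\<^sub>j\<close>, and the dimensions compare (\<open>tor_dim_retract\<close>).
  The argument applies to any two resolutions, in particular to those by which the two Betti numbers
  are evaluated.

  Such resolutions exist (\<open>resolution_exists\<close>): cover every successive kernel by a free module with one
  basis element for each member of a \<open>K\<close>-basis of each graded piece.  The graded pieces are
  finite-dimensional, so this produces finitely many basis elements in each degree.

  Two facts about the algebras enter.  They are the images of their toric maps; for \<open>R(I)\<close> this is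
  \<open>rees_algebra_eq\<close>.  And the kernels of the toric maps are homogeneous, because a monomial determines its
  standard degree: it is \<open>|c| / 2\<close> for \<open>x\<^sup>c\<close> in \<open>K[G]\<close> and \<open>|c| - s\<close> for \<open>x\<^sup>c T\<^sup>s\<close> in \<open>R(I)\<close>.
\<close>

section \<open>Graded polynomial rings and substitutions\<close>

abbreviation lookup where "lookup \<equiv> Poly_Mapping.lookup"
abbreviation keys where "keys \<equiv> Poly_Mapping.keys"
abbreviation single where "single \<equiv> Poly_Mapping.single"

lemma sum_single_lookup:
  assumes "finite S" "keys f \<subseteq> S"
  shows "f = (\<Sum>k\<in>S. single k (lookup f k))"
proof (rule poly_mapping_eqI)
  fix k
  have "lookup (\<Sum>k\<in>S. single k (lookup f k)) k = (\<Sum>k'\<in>S. if k' = k then lookup f k' else 0)"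
    by (auto simp: lookup_sum lookup_single when_def intro!: sum.cong)
  also have "\<dots> = lookup f k"
    using assms by (auto simp: sum.delta in_keys_iff)
  finally show "lookup f k = lookup (\<Sum>k\<in>S. single k (lookup f k)) k" by simp
qed

text \<open>
  The relation \<open>R\<close> carries what is known about the single terms of \<open>f\<close>, such as their degree, into
  the case of a single term; it need not be preserved by sums.
\<close>
lemma poly_mapping_keys_induct [case_names keys zero single add]:
  fixes f :: "'a \<Rightarrow>\<^sub>0 'b::comm_monoid_add"
  assumes "\<And>k. k \<in> keys f \<Longrightarrow> R k (lookup f k)"
    and zero: "P 0"
    and single: "\<And>k c. R k c \<Longrightarrow> P (single k c)"
    and add: "\<And>f g. P f \<Longrightarrow> P g \<Longrightarrow> P (f + g)"
  shows "P f"
proof -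
  have "P (\<Sum>k\<in>S. single k (lookup f k))" if "finite S" "S \<subseteq> keys f" for S
    using that by (induction S) (auto intro!: zero add single assms(1))
  from this[of "keys f"] show ?thesis
    using sum_single_lookup[of "keys f" f] by simp
qed

lemma poly_mapping_add_induct [case_names zero single add]:
  fixes f :: "'a \<Rightarrow>\<^sub>0 'b::comm_monoid_add"
  assumes "P 0" "\<And>k c. P (single k c)" "\<And>f g. P f \<Longrightarrow> P g \<Longrightarrow> P (f + g)"
  shows "P f"
  by (rule poly_mapping_keys_induct[where R = "\<lambda>_ _. True"]) (use assms in auto)

lemma add_in_mpolys: "p \<in> mpolys V \<Longrightarrow> q \<in> mpolys V \<Longrightarrow> p + q \<in> mpolys V"
  using Poly_Mapping.keys_add[of p q] by (auto simp: mpolys_def)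

lemma mpolys_induct [consumes 1, case_names zero single add]:
  assumes "p \<in> mpolys V"
    and "P 0"
    and single: "\<And>m c. keys m \<subseteq> V \<Longrightarrow> P (single m c)"
    and "\<And>p q. p \<in> mpolys V \<Longrightarrow> q \<in> mpolys V \<Longrightarrow> P p \<Longrightarrow> P q \<Longrightarrow> P (p + q)"
  shows "P p"
proof -
  have "p \<in> mpolys V \<and> P p"
  proof (rule poly_mapping_keys_induct[where R = "\<lambda>m c. keys m \<subseteq> V"])
    show "p + q \<in> mpolys V \<and> P (p + q)" if "p \<in> mpolys V \<and> P p" "q \<in> mpolys V \<and> P q" for p q
      using that assms(4)[of p q] add_in_mpolys by blast
  qed (use assms in \<open>auto simp: mpolys_def\<close>)
  then show ?thesis by simp
qed

lemma mdeg_superset: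
  assumes "finite S" "keys m \<subseteq> S"
  shows "mdeg m = (\<Sum>v\<in>S. lookup m v)"
  unfolding mdeg_def using assms by (intro sum.mono_neutral_left) (auto simp: in_keys_iff)

lemma mdeg_add: "mdeg (m + m') = mdeg m + mdeg m'"
proof -
  let ?S = "keys m \<union> keys m'"
  have "finite ?S" "keys m \<subseteq> ?S" "keys m' \<subseteq> ?S" "keys (m + m') \<subseteq> ?S"
    using Poly_Mapping.keys_add[of m m'] by auto
  then show ?thesis
    by (simp add: mdeg_superset[of ?S] lookup_add sum.distrib)
qed

lemma mdeg_zero [simp]: "mdeg 0 = 0"
  by (simp add: mdeg_def)

lemma mdeg_single [simp]: "mdeg (single v k) = k"
  by (simp add: mdeg_def)

lemma mdeg_eq_0_iff: "mdeg m = 0 \<longleftrightarrow> m = 0"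
  by (auto simp: mdeg_def in_keys_iff intro: poly_mapping_eqI)

lemma keys_add_subset: "keys f \<subseteq> S \<Longrightarrow> keys g \<subseteq> S \<Longrightarrow> keys (f + g) \<subseteq> S"
  using Poly_Mapping.keys_add[of f g] by auto

lemma monomial_induct [consumes 1, case_names zero var]:
  fixes m :: "'v \<Rightarrow>\<^sub>0 nat"
  assumes "keys m \<subseteq> V"
    and "P 0"
    and var: "\<And>v m. v \<in> V \<Longrightarrow> keys m \<subseteq> V \<Longrightarrow> P m \<Longrightarrow> P (single v 1 + m)"
  shows "P m"
  using assms(1)
proof (induction "mdeg m" arbitrary: m)
  case 0
  then show ?case using assms(2) by (simp add: mdeg_eq_0_iff)
next
  case (Suc k)
  then have "m \<noteq> 0" by auto
  then obtain v where v: "v \<in> keys m" by (metis all_not_in_conv keys_eq_empty)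
  define m' where "m' = m - single v 1"
  have m: "m = single v 1 + m'"
    using v by (intro poly_mapping_eqI)
      (auto simp: m'_def lookup_add lookup_minus lookup_single when_def in_keys_iff)
  have sub: "keys m' \<subseteq> V"
    using Suc.prems v by (auto simp: m'_def in_keys_iff lookup_minus lookup_single)
  have "mdeg m' = k" using Suc.hyps(2) m by (simp add: mdeg_add)
  then have "P m'" using Suc.hyps(1) sub by simp
  then show ?case using var[of v m'] v Suc.prems sub m by auto
qed

lemma zero_in_mpolys [simp]: "0 \<in> mpolys V"
  by (simp add: mpolys_def)

lemma mconst_in_mpolys [simp]: "mconst c \<in> mpolys V"
  by (auto simp: mpolys_def mconst_def)

lemma one_in_mpolys [simp]: "1 \<in> mpolys V"
  by (simp add: mpolys_def)

lemma single_in_mpolys: "keys m \<subseteq> V \<Longrightarrow> single m c \<in> mpolys V"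
  by (auto simp: mpolys_def)

lemma mvar_in_mpolys: "v \<in> V \<Longrightarrow> mvar v \<in> mpolys V"
  by (simp add: mvar_def single_in_mpolys)

lemma uminus_in_mpolys: "p \<in> mpolys V \<Longrightarrow> - p \<in> mpolys V"
  by (simp add: mpolys_def in_keys_iff)

lemma diff_in_mpolys: "p \<in> mpolys V \<Longrightarrow> q \<in> mpolys V \<Longrightarrow> p - q \<in> mpolys V"
  using add_in_mpolys[of p V "- q"] uminus_in_mpolys[of q V] by simp

lemma mult_in_mpolys:
  assumes "p \<in> mpolys V" "q \<in> mpolys V"
  shows "p * q \<in> mpolys V"
proof -
  have "keys m \<subseteq> V" if m: "m \<in> keys (p * q)" for m
  proof -
    obtain a b where "m = a + b" "a \<in> keys p" "b \<in> keys q"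
      using Poly_Mapping.keys_mult[of p q] m by blast
    then show ?thesis using assms keys_add_subset[of a V b] by (simp add: mpolys_def)
  qed
  then show ?thesis by (simp add: mpolys_def)
qed

lemma zero_in_hom_mpolys [simp]: "0 \<in> hom_mpolys V j"
  by (simp add: hom_mpolys_def)

lemma add_in_hom_mpolys: "p \<in> hom_mpolys V j \<Longrightarrow> q \<in> hom_mpolys V j \<Longrightarrow> p + q \<in> hom_mpolys V j"
  using Poly_Mapping.keys_add[of p q] by (auto simp: hom_mpolys_def add_in_mpolys)

lemma uminus_in_hom_mpolys: "p \<in> hom_mpolys V j \<Longrightarrow> - p \<in> hom_mpolys V j"
  by (auto simp: hom_mpolys_def uminus_in_mpolys in_keys_iff)

lemma mult_in_hom_mpolys:
  assumes "p \<in> hom_mpolys V i" "q \<in> hom_mpolys V j"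
  shows "p * q \<in> hom_mpolys V (i + j)"
proof -
  have "int (mdeg m) = i + j" if m: "m \<in> keys (p * q)" for m
  proof -
    obtain a b where "m = a + b" "a \<in> keys p" "b \<in> keys q"
      using Poly_Mapping.keys_mult[of p q] m by blast
    then show ?thesis using assms by (simp add: hom_mpolys_def mdeg_add)
  qed
  then show ?thesis using assms by (simp add: hom_mpolys_def mult_in_mpolys)
qed

lemma mconst_in_hom_mpolys [simp]: "mconst c \<in> hom_mpolys V 0"
  by (simp add: hom_mpolys_def) (simp add: mconst_def)

lemma one_in_hom_mpolys [simp]: "1 \<in> hom_mpolys V 0"
  by (simp add: hom_mpolys_def)

lemma mvar_in_hom_mpolys: "v \<in> V \<Longrightarrow> mvar v \<in> hom_mpolys V 1"
  by (auto simp: hom_mpolys_def mvar_in_mpolys) (simp add: mvar_def)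

lemma single_in_hom_mpolys: "keys m \<subseteq> V \<Longrightarrow> single m c \<in> hom_mpolys V (int (mdeg m))"
  by (auto simp: hom_mpolys_def mpolys_def)

lemma hom_mpolys_subset: "hom_mpolys V j \<subseteq> mpolys V"
  by (auto simp: hom_mpolys_def)

lemma mconst_0 [simp]: "mconst 0 = 0" and mconst_1 [simp]: "mconst 1 = 1"
  and mconst_add: "mconst (a + b) = mconst a + mconst b"
  and mconst_mult: "mconst (a * b) = mconst a * mconst b"
  by (simp_all add: mconst_def single_add mult_single)

lemma single_conv_mconst: "single m c = mconst c * single m 1"
  by (simp add: mconst_def mult_single)

lemma single_mvar_add: "single (single v 1 + m) 1 = mvar v * single m 1"
  by (simp add: mvar_def mult_single)

definition hom_part :: "int \<Rightarrow> ('v, 'k::comm_ring_1) mpoly \<Rightarrow> ('v, 'k) mpoly" where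
  "hom_part j = Poly_Mapping.mapp (\<lambda>m c. if int (mdeg m) = j then c else 0)"

lemma lookup_hom_part: "lookup (hom_part j p) m = (if int (mdeg m) = j then lookup p m else 0)"
  by (simp add: hom_part_def lookup_mapp when_def in_keys_iff)

lemma hom_part_add: "hom_part j (p + q) = hom_part j p + hom_part j q"
  by (rule poly_mapping_eqI) (simp add: lookup_hom_part lookup_add)

lemma hom_part_zero [simp]: "hom_part j 0 = 0"
  by (rule poly_mapping_eqI) (simp add: lookup_hom_part)

lemma hom_part_single: "hom_part j (single m c) = (if int (mdeg m) = j then single m c else 0)"
  by (rule poly_mapping_eqI) (auto simp add: lookup_hom_part lookup_single when_def)

lemma hom_part_in_hom_mpolys: "p \<in> mpolys V \<Longrightarrow> hom_part j p \<in> hom_mpolys V j"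
  by (auto simp: hom_mpolys_def mpolys_def in_keys_iff lookup_hom_part split: if_splits)

lemma hom_part_hom: "p \<in> hom_mpolys V i \<Longrightarrow> hom_part j p = (if i = j then p else 0)"
  by (rule poly_mapping_eqI) (auto simp: hom_mpolys_def lookup_hom_part in_keys_iff)

locale scalar_hom =
  fixes \<iota> :: "'k::field \<Rightarrow> 'r::comm_ring_1"
  assumes scalar_zero [simp]: "\<iota> 0 = 0"
    and scalar_one [simp]: "\<iota> 1 = 1"
    and scalar_add: "\<iota> (a + b) = \<iota> a + \<iota> b"
    and scalar_mult: "\<iota> (a * b) = \<iota> a * \<iota> b"

definition eval_monom :: "('v \<Rightarrow> 'r::comm_ring_1) \<Rightarrow> ('v \<Rightarrow>\<^sub>0 nat) \<Rightarrow> 'r" where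
  "eval_monom \<sigma> m = (\<Prod>v\<in>keys m. \<sigma> v ^ lookup m v)"

text \<open>
  One substitution homomorphism serves for the toric maps, for renaming variables and for setting
  variables to zero.
\<close>
definition eval_at :: "('k::field \<Rightarrow> 'r::comm_ring_1) \<Rightarrow> ('v \<Rightarrow> 'r) \<Rightarrow> ('v, 'k) mpoly \<Rightarrow> 'r" where
  "eval_at \<iota> \<sigma> p = (\<Sum>m\<in>keys p. \<iota> (lookup p m) * eval_monom \<sigma> m)"

lemma toric_map_eq_eval_at: "toric_map \<iota> = eval_at \<iota> (\<lambda>u. u)"
  by (rule ext) (simp add: toric_map_def eval_at_def eval_monom_def)

lemma eval_monom_superset:
  "finite S \<Longrightarrow> keys m \<subseteq> S \<Longrightarrow> eval_monom \<sigma> m = (\<Prod>v\<in>S. \<sigma> v ^ lookup m v)"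
  unfolding eval_monom_def by (intro prod.mono_neutral_left) (auto simp: in_keys_iff)

lemma eval_monom_zero [simp]: "eval_monom \<sigma> 0 = 1"
  by (simp add: eval_monom_def)

lemma eval_monom_single [simp]: "eval_monom \<sigma> (single v k) = \<sigma> v ^ k"
  by (simp add: eval_monom_def)

lemma eval_monom_add: "eval_monom \<sigma> (m + m') = eval_monom \<sigma> m * eval_monom \<sigma> m'"
proof -
  let ?S = "keys m \<union> keys m'"
  have "finite ?S" "keys m \<subseteq> ?S" "keys m' \<subseteq> ?S" "keys (m + m') \<subseteq> ?S"
    using Poly_Mapping.keys_add[of m m'] by auto
  then show ?thesis
    by (simp add: eval_monom_superset[of ?S] lookup_add power_add prod.distrib)
qed

context scalar_hom
begin

lemma eval_at_zero [simp]: "eval_at \<iota> \<sigma> 0 = 0"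
  by (simp add: eval_at_def)

lemma eval_at_single: "eval_at \<iota> \<sigma> (single m c) = \<iota> c * eval_monom \<sigma> m"
  by (cases "c = 0") (simp_all add: eval_at_def)

lemma eval_at_mconst [simp]: "eval_at \<iota> \<sigma> (mconst c) = \<iota> c"
  by (simp add: mconst_def eval_at_single)

lemma eval_at_one [simp]: "eval_at \<iota> \<sigma> 1 = 1"
  using eval_at_mconst[of \<sigma> 1] by simp

lemma eval_at_mvar [simp]: "eval_at \<iota> \<sigma> (mvar v) = \<sigma> v"
  by (simp add: mvar_def eval_at_single)

lemma eval_at_add: "eval_at \<iota> \<sigma> (p + q) = eval_at \<iota> \<sigma> p + eval_at \<iota> \<sigma> q"
  unfolding eval_at_def
  by (rule Poly_Mapping.setsum_keys_plus_distrib) (simp_all add: scalar_add distrib_right)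

lemma eval_at_mult: "eval_at \<iota> \<sigma> (p * q) = eval_at \<iota> \<sigma> p * eval_at \<iota> \<sigma> q"
proof (induction p rule: poly_mapping_add_induct)
  case (single m c)
  show ?case
    by (induction q rule: poly_mapping_add_induct)
      (simp_all add: mult_single eval_at_single eval_monom_add scalar_mult distrib_left eval_at_add)
qed (simp_all add: distrib_right eval_at_add)

lemma eval_at_uminus: "eval_at \<iota> \<sigma> (- p) = - eval_at \<iota> \<sigma> p"
  using eval_at_add[of \<sigma> p "- p"] by (simp add: eq_neg_iff_add_eq_0 add.commute)

lemma eval_at_diff: "eval_at \<iota> \<sigma> (p - q) = eval_at \<iota> \<sigma> p - eval_at \<iota> \<sigma> q"
  using eval_at_add[of \<sigma> p "- q"] by (simp add: eval_at_uminus)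

end

interpretation mconst: scalar_hom "mconst :: 'k::field \<Rightarrow> ('v, 'k) mpoly"
  by standard (simp_all add: mconst_add mconst_mult)

text \<open>
  Substitutions are additive and multiplicative on all polynomials, and only the grading refers to
  the sets of variables.
\<close>
locale graded_hom =
  fixes U :: "'v set" and U' :: "'w set"
    and h :: "('v, 'k::field) mpoly \<Rightarrow> ('w, 'k) mpoly"
  assumes hom_add: "h (p + q) = h p + h q"
    and hom_mult: "h (p * q) = h p * h q"
    and hom_mconst [simp]: "h (mconst c) = mconst c"
    and hom_degree: "p \<in> hom_mpolys U j \<Longrightarrow> h p \<in> hom_mpolys U' j"
begin

lemma hom_zero [simp]: "h 0 = 0" and hom_one [simp]: "h 1 = 1"
  using hom_mconst[of 0] hom_mconst[of 1] by simp_all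

lemma hom_in_mpolys: "p \<in> mpolys U \<Longrightarrow> h p \<in> mpolys U'"
proof (induction p rule: mpolys_induct)
  case (single m c)
  then show ?case using hom_degree single_in_hom_mpolys hom_mpolys_subset by blast
qed (simp_all add: hom_add add_in_mpolys)

text \<open>
  The image of a monomial other than \<open>1\<close> is homogeneous of positive degree; hence the irrelevant ideal
  is mapped into the irrelevant ideal.  This is what makes semilinear maps descend to the tensor
  product with \<open>K\<close>.
\<close>
lemma hom_constant_term: "p \<in> mpolys U \<Longrightarrow> lookup (h p) 0 = lookup p 0"
proof (induction p rule: mpolys_induct)
  case (single m c)
  show ?case
  proof (cases "m = 0")
    case True
    then show ?thesis using hom_mconst[of c] by (simp add: mconst_def)
  next
    case False
    have "h (single m c) \<in> hom_mpolys U' (int (mdeg m))"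
      using single by (intro hom_degree single_in_hom_mpolys)
    then have "0 \<notin> keys (h (single m c))"
      using False by (auto simp: hom_mpolys_def mdeg_eq_0_iff)
    then show ?thesis
      using False by (simp add: in_keys_iff lookup_single)
  qed
qed (simp_all add: hom_add lookup_add)

end

lemma graded_hom_id: "graded_hom U U (\<lambda>p. p)"
  by standard auto

lemma graded_hom_eval_at:
  fixes \<sigma> :: "'v \<Rightarrow> ('w, 'k::field) mpoly"
  assumes "\<And>v. v \<in> U \<Longrightarrow> \<sigma> v \<in> hom_mpolys U' 1"
  shows "graded_hom U U' (eval_at mconst \<sigma>)"
proof
  fix p :: "('v, 'k) mpoly" and j assume p: "p \<in> hom_mpolys U j"
  have monom: "eval_monom \<sigma> m \<in> hom_mpolys U' (int (mdeg m))" if "keys m \<subseteq> U" for m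
    using that
  proof (induction m rule: monomial_induct)
    case (var v m)
    then show ?case
      using mult_in_hom_mpolys[OF assms[OF var(1)] var(3)] by (simp add: eval_monom_add mdeg_add)
  qed simp
  have "mconst c * eval_monom \<sigma> m \<in> hom_mpolys U' j" if "keys m \<subseteq> U \<and> int (mdeg m) = j" for m c
    using mult_in_hom_mpolys[OF mconst_in_hom_mpolys[of c U'] monom[of m]] that by simp
  note term_hom = this
  show "eval_at mconst \<sigma> p \<in> hom_mpolys U' j"
  proof (rule poly_mapping_keys_induct[where R = "\<lambda>m c. keys m \<subseteq> U \<and> int (mdeg m) = j"])
    show "keys m \<subseteq> U \<and> int (mdeg m) = j" if "m \<in> keys p" for m
      using p that by (simp add: hom_mpolys_def mpolys_def)
  qed (simp_all add: mconst.eval_at_single mconst.eval_at_add add_in_hom_mpolys term_hom)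
qed (simp_all add: mconst.eval_at_add mconst.eval_at_mult)

section \<open>Graded free modules and their maps\<close>

lemma lookup_map_zero: "g 0 = 0 \<Longrightarrow> lookup (Poly_Mapping.map g f) b = g (lookup f b)"
  by (simp add: Poly_Mapping.map.rep_eq when_def)

lemma lookup_smul: "lookup (smul a f) b = a * lookup f b"
  by (simp add: smul_def lookup_map_zero)

lemma smul_add_right: "smul a (f + g) = smul a f + smul a g"
  and smul_diff_right: "smul a (f - g) = smul a f - smul a g"
  and smul_add_left: "smul (a + b) f = smul a f + smul b f"
  and smul_smul: "smul a (smul b f) = smul (a * b) f"
  and smul_one [simp]: "smul 1 f = f"
  and smul_zero_left [simp]: "smul 0 f = 0"
  and smul_zero_right [simp]: "smul a 0 = 0"
  by (auto intro!: poly_mapping_eqI simp: lookup_smul lookup_add lookup_minus algebra_simps)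

lemma smul_single: "smul a (single b p) = single b (a * p)"
  by (rule poly_mapping_eqI) (simp add: lookup_smul lookup_single when_def)

lemma zero_in_free_mod [simp]: "0 \<in> free_mod V B"
  by (simp add: free_mod_def)

lemma add_in_free_mod: "f \<in> free_mod V B \<Longrightarrow> g \<in> free_mod V B \<Longrightarrow> f + g \<in> free_mod V B"
  by (simp add: free_mod_def lookup_add add_in_mpolys keys_add_subset)

lemma uminus_in_free_mod: "f \<in> free_mod V B \<Longrightarrow> - f \<in> free_mod V B"
  by (simp add: free_mod_def uminus_in_mpolys)

lemma smul_in_free_mod: "p \<in> mpolys V \<Longrightarrow> f \<in> free_mod V B \<Longrightarrow> smul p f \<in> free_mod V B"
  by (simp add: free_mod_def lookup_smul mult_in_mpolys subset_iff in_keys_iff) (metis mult_zero_right)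

lemma single_in_free_mod: "b \<in> B \<Longrightarrow> p \<in> mpolys V \<Longrightarrow> single b p \<in> free_mod V B"
  by (auto simp: free_mod_def lookup_single when_def)

lemma free_component_subset: "free_component V B d j \<subseteq> free_mod V B"
  by (auto simp: free_component_def)

lemma zero_in_free_component [simp]: "0 \<in> free_component V B d j"
  by (simp add: free_component_def)

lemma add_in_free_component:
  "f \<in> free_component V B d j \<Longrightarrow> g \<in> free_component V B d j \<Longrightarrow> f + g \<in> free_component V B d j"
  by (simp add: free_component_def add_in_free_mod lookup_add add_in_hom_mpolys)

lemma uminus_in_free_component:
  "f \<in> free_component V B d j \<Longrightarrow> - f \<in> free_component V B d j"
  by (simp add: free_component_def uminus_in_free_mod uminus_in_hom_mpolys)

lemma diff_in_free_component:
  "f \<in> free_component V B d j \<Longrightarrow> g \<in> free_component V B d j \<Longrightarrow> f - g \<in> free_component V B d j"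
  using add_in_free_component[of f V B d j "- g"] uminus_in_free_component[of g V B d j] by simp

lemma sum_in_free_component:
  "(\<And>x. x \<in> X \<Longrightarrow> f x \<in> free_component V B d j) \<Longrightarrow> sum f X \<in> free_component V B d j"
  by (induction X rule: infinite_finite_induct) (auto intro: add_in_free_component)

lemma smul_in_free_component:
  assumes "p \<in> hom_mpolys V i" "f \<in> free_component V B d j"
  shows "smul p f \<in> free_component V B d (i + j)"
proof -
  have "p \<in> mpolys V" using assms(1) hom_mpolys_subset by blast
  then show ?thesis
    using assms mult_in_hom_mpolys[OF assms(1), of "lookup f b" "j - d b" for b]
    by (simp add: free_component_def smul_in_free_mod lookup_smul add_diff_eq)
qed

lemma single_in_free_component:
  "b \<in> B \<Longrightarrow> p \<in> hom_mpolys V (j - d b) \<Longrightarrow> single b p \<in> free_component V B d j"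
  using hom_mpolys_subset[of V "j - d b"]
  by (auto simp: free_component_def single_in_free_mod lookup_single when_def)

lemma unit_in_free_component: "b \<in> B \<Longrightarrow> single b 1 \<in> free_component V B d (d b)"
  by (simp add: single_in_free_component)

lemma free_mod_induct [consumes 1, case_names zero single add]:
  assumes f: "f \<in> free_mod V B"
    and zero: "P 0"
    and single: "\<And>b m c. b \<in> B \<Longrightarrow> keys m \<subseteq> V \<Longrightarrow> P (single b (single m c))"
    and add: "\<And>f g. f \<in> free_mod V B \<Longrightarrow> g \<in> free_mod V B \<Longrightarrow> P f \<Longrightarrow> P g \<Longrightarrow> P (f + g)"
  shows "P f"
proof -
  have "P (single b p)" if "b \<in> B" "p \<in> mpolys V" for b p
    using that(2)
    by (induction p rule: mpolys_induct) (simp_all add: zero single that(1) single_add add single_in_free_mod)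
  moreover have "f \<in> free_mod V B \<and> P f"
  proof (rule poly_mapping_keys_induct[where R = "\<lambda>b p. b \<in> B \<and> p \<in> mpolys V"])
    show "b \<in> B \<and> lookup f b \<in> mpolys V" if "b \<in> keys f" for b
      using f that by (auto simp: free_mod_def)
  qed (use calculation zero add in \<open>simp_all add: single_in_free_mod add_in_free_mod\<close>)
  ultimately show ?thesis by simp
qed

text \<open>
  The target is an abelian group on which the scalars act through \<open>act\<close>.  This covers maps between free
  modules over two different polynomial rings (\<open>act p = smul (h p)\<close>) as well as the augmentation onto
  the algebra (\<open>act p\<close> is multiplication by the image of \<open>p\<close>).
\<close>
definition semilinear ::
    "(('v, 'k::comm_ring_1) mpoly \<Rightarrow> 'x \<Rightarrow> 'x::ab_group_add) \<Rightarrow> 'v set \<Rightarrow> 'b set \<Rightarrow>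
     (('b \<Rightarrow>\<^sub>0 ('v, 'k) mpoly) \<Rightarrow> 'x) \<Rightarrow> bool" where
  "semilinear act U B \<phi> \<longleftrightarrow>
     (\<forall>f\<in>free_mod U B. \<forall>g\<in>free_mod U B. \<phi> (f + g) = \<phi> f + \<phi> g) \<and>
     (\<forall>p\<in>mpolys U. \<forall>f\<in>free_mod U B. \<phi> (smul p f) = act p (\<phi> f))"

lemma semilinear_add:
  "semilinear act U B \<phi> \<Longrightarrow> f \<in> free_mod U B \<Longrightarrow> g \<in> free_mod U B \<Longrightarrow> \<phi> (f + g) = \<phi> f + \<phi> g"
  and semilinear_smul:
  "semilinear act U B \<phi> \<Longrightarrow> p \<in> mpolys U \<Longrightarrow> f \<in> free_mod U B \<Longrightarrow> \<phi> (smul p f) = act p (\<phi> f)"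
  by (simp_all add: semilinear_def)

lemma semilinear_zero: "semilinear act U B \<phi> \<Longrightarrow> \<phi> 0 = 0"
  using semilinear_add[of act U B \<phi> 0 0] by simp

lemma semilinear_uminus:
  "semilinear act U B \<phi> \<Longrightarrow> f \<in> free_mod U B \<Longrightarrow> \<phi> (- f) = - \<phi> f"
  using semilinear_add[of act U B \<phi> f "- f"] semilinear_zero[of act U B \<phi>]
  by (simp add: uminus_in_free_mod eq_neg_iff_add_eq_0 add.commute)

lemma semilinear_diff:
  "semilinear act U B \<phi> \<Longrightarrow> f \<in> free_mod U B \<Longrightarrow> g \<in> free_mod U B \<Longrightarrow> \<phi> (f - g) = \<phi> f - \<phi> g"
  using semilinear_add[of act U B \<phi> f "- g"] semilinear_uminus[of act U B \<phi> g]
  by (simp add: uminus_in_free_mod)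

lemma semilinear_eqI:
  assumes "semilinear act U B \<phi>" "semilinear act U B \<psi>"
    and "\<And>b. b \<in> B \<Longrightarrow> \<phi> (single b 1) = \<psi> (single b 1)"
    and "f \<in> free_mod U B"
  shows "\<phi> f = \<psi> f"
  using assms(4)
proof (induction f rule: free_mod_induct)
  case (single b m c)
  have "\<chi> (single b (single m c)) = act (single m c) (\<chi> (single b 1))" if "semilinear act U B \<chi>" for \<chi>
    using semilinear_smul[OF that, of "single m c" "single b 1"] single
    by (simp add: smul_single single_in_mpolys single_in_free_mod)
  from this[OF assms(1)] this[OF assms(2)] show ?case using assms(3)[OF single(1)] by simp
next
  case (add f g)
  then show ?case
    using semilinear_add[OF assms(1), of f g] semilinear_add[OF assms(2), of f g] by simp
qed (simp add: semilinear_zero[OF assms(1)] semilinear_zero[OF assms(2)])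

definition graded_map ::
    "(('v, 'k::field) mpoly \<Rightarrow> ('w, 'k) mpoly) \<Rightarrow> 'v set \<Rightarrow> 'b set \<Rightarrow> ('b \<Rightarrow> int) \<Rightarrow>
     'w set \<Rightarrow> 'c set \<Rightarrow> ('c \<Rightarrow> int) \<Rightarrow>
     (('b \<Rightarrow>\<^sub>0 ('v, 'k) mpoly) \<Rightarrow> ('c \<Rightarrow>\<^sub>0 ('w, 'k) mpoly)) \<Rightarrow> bool" where
  "graded_map h U B d U' B' d' \<phi> \<longleftrightarrow>
     semilinear (\<lambda>p. smul (h p)) U B \<phi> \<and>
     (\<forall>j. \<phi> ` free_component U B d j \<subseteq> free_component U' B' d' j)"

lemma graded_map_semilinear: "graded_map h U B d U' B' d' \<phi> \<Longrightarrow> semilinear (\<lambda>p. smul (h p)) U B \<phi>"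
  by (simp add: graded_map_def)

lemma graded_map_component:
  "graded_map h U B d U' B' d' \<phi> \<Longrightarrow> f \<in> free_component U B d j \<Longrightarrow> \<phi> f \<in> free_component U' B' d' j"
  by (auto simp: graded_map_def)

lemmas graded_map_add = semilinear_add[OF graded_map_semilinear]
  and graded_map_diff = semilinear_diff[OF graded_map_semilinear]
  and graded_map_zero = semilinear_zero[OF graded_map_semilinear]
  and graded_map_smul = semilinear_smul[OF graded_map_semilinear]

lemma graded_map_in_free_mod:
  assumes "graded_map h U B d U' B' d' \<phi>" "f \<in> free_mod U B"
  shows "\<phi> f \<in> free_mod U' B'"
  using assms(2)
proof (induction f rule: free_mod_induct)
  case zero
  then show ?case using graded_map_zero[OF assms(1)] by simp
next
  case (single b m c)
  then have "single b (single m c) \<in> free_component U B d (int (mdeg m) + d b)"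
    by (simp add: single_in_free_component single_in_hom_mpolys)
  then show ?case
    using graded_map_component[OF assms(1)] free_component_subset by blast
next
  case (add f g)
  then show ?case using graded_map_add[OF assms(1)] by (simp add: add_in_free_mod)
qed

lemma graded_map_id: "graded_map (\<lambda>p. p) U B d U B d (\<lambda>f. f)"
  by (simp add: graded_map_def semilinear_def)

lemma semilinear_comp:
  assumes h: "graded_hom U U' h" and \<phi>: "graded_map h U B d U' B' d' \<phi>"
    and \<psi>: "semilinear act U' B' \<psi>"
  shows "semilinear (\<lambda>p. act (h p)) U B (\<lambda>f. \<psi> (\<phi> f))"
  unfolding semilinear_def
  by (auto simp: graded_map_add[OF \<phi>] graded_map_smul[OF \<phi>] graded_map_in_free_mod[OF \<phi>]
      semilinear_add[OF \<psi>] semilinear_smul[OF \<psi>] graded_hom.hom_in_mpolys[OF h])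

lemma graded_map_comp:
  assumes "graded_hom U U' h" "graded_map h U B d U' B' d' \<phi>" "graded_map h' U' B' d' U'' B'' d'' \<psi>"
  shows "graded_map (\<lambda>p. h' (h p)) U B d U'' B'' d'' (\<lambda>f. \<psi> (\<phi> f))"
  using semilinear_comp[OF assms(1,2) graded_map_semilinear[OF assms(3)]]
    graded_map_component[OF assms(2)] graded_map_component[OF assms(3)]
  by (auto simp: graded_map_def)

lemma graded_map_minus:
  assumes "graded_map h U B d U' B' d' \<phi>" "graded_map h U B d U' B' d' \<psi>"
  shows "graded_map h U B d U' B' d' (\<lambda>f. \<phi> f - \<psi> f)"
  unfolding graded_map_def semilinear_def
  by (simp add: graded_map_add[OF assms(1)] graded_map_add[OF assms(2)] graded_map_smul[OF assms(1)]
      graded_map_smul[OF assms(2)] smul_diff_right image_subset_iff diff_in_free_component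
      graded_map_component[OF assms(1)] graded_map_component[OF assms(2)])

definition free_part :: "('b \<Rightarrow> int) \<Rightarrow> int \<Rightarrow> ('b \<Rightarrow>\<^sub>0 ('v, 'k::comm_ring_1) mpoly) \<Rightarrow> ('b \<Rightarrow>\<^sub>0 ('v, 'k) mpoly)" where
  "free_part d j = Poly_Mapping.mapp (\<lambda>b. hom_part (j - d b))"

lemma lookup_free_part: "lookup (free_part d j f) b = hom_part (j - d b) (lookup f b)"
  by (auto simp add: free_part_def lookup_mapp when_def in_keys_iff)

lemma free_part_zero [simp]: "free_part d j 0 = 0"
  by (rule poly_mapping_eqI) (simp add: lookup_free_part)

lemma free_part_add: "free_part d j (f + g) = free_part d j f + free_part d j g"
  by (rule poly_mapping_eqI) (simp add: lookup_free_part lookup_add hom_part_add)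

lemma free_part_in_free_component:
  assumes "f \<in> free_mod V B"
  shows "free_part d j f \<in> free_component V B d j"
proof -
  have hom: "lookup (free_part d j f) b \<in> hom_mpolys V (j - d b)" for b
    using assms by (simp add: lookup_free_part hom_part_in_hom_mpolys free_mod_def)
  moreover have "keys (free_part d j f) \<subseteq> keys f"
    by (auto simp: lookup_free_part in_keys_iff)
  moreover have "lookup (free_part d j f) b \<in> mpolys V" for b
    using hom hom_mpolys_subset by blast
  ultimately show ?thesis
    using assms by (auto simp: free_component_def free_mod_def)
qed

lemma free_part_in_free_mod: "f \<in> free_mod V B \<Longrightarrow> free_part d j f \<in> free_mod V B"
  using free_part_in_free_component free_component_subset by blast

lemma free_part_component:
  assumes "f \<in> free_component V B d i"
  shows "free_part d j f = (if i = j then f else 0)"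
proof (rule poly_mapping_eqI)
  fix b
  have "lookup f b \<in> hom_mpolys V (i - d b)" using assms by (simp add: free_component_def)
  from hom_part_hom[OF this, of "j - d b"]
  show "lookup (free_part d j f) b = lookup (if i = j then f else 0) b" by (simp add: lookup_free_part)
qed

text \<open>
  Both sides are additive in \<open>f\<close>, and on a homogeneous \<open>f\<close> both are \<open>\<phi> f\<close> or \<open>0\<close>.
\<close>
lemma graded_map_free_part:
  assumes \<phi>: "graded_map h U B d U' B' d' \<phi>" and "f \<in> free_mod U B"
  shows "\<phi> (free_part d j f) = free_part d' j (\<phi> f)"
  using assms(2)
proof (induction f rule: free_mod_induct)
  case zero
  then show ?case using graded_map_zero[OF \<phi>] by simp
next
  case (single b m c)
  then have "single b (single m c) \<in> free_component U B d (int (mdeg m) + d b)"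
    by (simp add: single_in_free_component single_in_hom_mpolys)
  from free_part_component[OF this] free_part_component[OF graded_map_component[OF \<phi> this]]
  show ?case using graded_map_zero[OF \<phi>] by simp
next
  case (add f g)
  then show ?case using graded_map_add[OF \<phi>] by (simp add: free_part_add free_part_in_free_mod)
qed

text \<open>
  The component of degree \<open>j\<close> of an arbitrary preimage is again a preimage.
\<close>
lemma homogeneous_preimage:
  assumes \<phi>: "graded_map h U B d U' B' d' \<phi>"
    and z: "z \<in> free_component U' B' d' j" "z \<in> \<phi> ` free_mod U B"
  obtains y where "y \<in> free_component U B d j" "\<phi> y = z"
proof -
  obtain y where y: "y \<in> free_mod U B" "z = \<phi> y" using z(2) by auto
  have "\<phi> (free_part d j y) = z"
    using graded_map_free_part[OF \<phi> y(1), of j] free_part_component[OF z(1), of j] y(2) by simp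
  then show thesis using that free_part_in_free_component[OF y(1)] by blast
qed

lemma free_extension:
  assumes h: "graded_hom U U' h"
    and y: "\<And>b. b \<in> B \<Longrightarrow> y b \<in> free_component U' B' d' (d b)"
  shows "\<exists>\<phi>. graded_map h U B d U' B' d' \<phi> \<and> (\<forall>b\<in>B. \<phi> (single b 1) = y b)"
proof -
  interpret graded_hom U U' h by fact
  define \<phi> where "\<phi> f = (\<Sum>b\<in>keys f. smul (h (lookup f b)) (y b))" for f
  have superset: "\<phi> f = (\<Sum>b\<in>S. smul (h (lookup f b)) (y b))" if "finite S" "keys f \<subseteq> S" for f S
    unfolding \<phi>_def using that by (intro sum.mono_neutral_left) (auto simp: in_keys_iff)
  have \<phi>_add: "\<phi> (f + f') = \<phi> f + \<phi> f'" for f f'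
    unfolding \<phi>_def
    by (rule Poly_Mapping.setsum_keys_plus_distrib) (simp_all add: hom_add smul_add_left)
  have \<phi>_smul: "\<phi> (smul p f) = smul (h p) (\<phi> f)" for p f
  proof -
    have "keys (smul p f) \<subseteq> keys f" by (auto simp: in_keys_iff lookup_smul)
    then have "\<phi> (smul p f) = (\<Sum>b\<in>keys f. smul (h p) (smul (h (lookup f b)) (y b)))"
      by (simp add: superset[of "keys f"] lookup_smul hom_mult smul_smul)
    also have "\<dots> = smul (h p) (\<phi> f)"
      unfolding \<phi>_def by (induction rule: infinite_finite_induct) (simp_all add: smul_add_right)
    finally show ?thesis .
  qed
  have "\<phi> f \<in> free_component U' B' d' j" if f: "f \<in> free_component U B d j" for f j
    unfolding \<phi>_def
  proof (rule sum_in_free_component)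
    fix b assume "b \<in> keys f"
    then have "b \<in> B" using f by (auto simp: free_component_def free_mod_def)
    moreover have "h (lookup f b) \<in> hom_mpolys U' (j - d b)"
      using f by (auto simp: free_component_def intro: hom_degree)
    ultimately show "smul (h (lookup f b)) (y b) \<in> free_component U' B' d' j"
      using smul_in_free_component[of _ U' "j - d b" "y b" B' d' "d b"] y by simp
  qed
  then have "graded_map h U B d U' B' d' \<phi>"
    by (auto simp: graded_map_def semilinear_def \<phi>_add \<phi>_smul)
  moreover have "\<phi> (single b 1) = y b" for b by (simp add: \<phi>_def)
  ultimately show ?thesis by blast
qed

text \<open>
  Freeness gives the lift: it suffices to choose homogeneous preimages of the images of the basis
  elements.  The target stays abstract so that the lemma applies to the augmentation and to the
  differentials alike.
\<close>
lemma lifting: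
  assumes h: "graded_hom U U' h"
    and g: "semilinear (\<lambda>p. act (h p)) U B g"
    and \<pi>: "semilinear act U' B' \<pi>"
    and pre: "\<And>b. b \<in> B \<Longrightarrow> \<exists>y\<in>free_component U' B' d' (d b). \<pi> y = g (single b 1)"
  shows "\<exists>\<phi>. graded_map h U B d U' B' d' \<phi> \<and> (\<forall>f\<in>free_mod U B. \<pi> (\<phi> f) = g f)"
proof -
  obtain y where y: "\<And>b. b \<in> B \<Longrightarrow> y b \<in> free_component U' B' d' (d b)"
      "\<And>b. b \<in> B \<Longrightarrow> \<pi> (y b) = g (single b 1)"
    using pre by metis
  obtain \<phi> where graded: "graded_map h U B d U' B' d' \<phi>" and "\<forall>b\<in>B. \<phi> (single b 1) = y b"
    using free_extension[where y = y, OF h y(1)] by blast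
  then have "\<pi> (\<phi> (single b 1)) = g (single b 1)" if "b \<in> B" for b
    using y(2) that by simp
  then have "\<pi> (\<phi> f) = g f" if "f \<in> free_mod U B" for f
    using semilinear_eqI[OF semilinear_comp[OF h graded \<pi>] g] that by blast
  with graded show ?thesis by blast
qed

section \<open>Comparison of graded free resolutions\<close>

text \<open>
  Homogeneity of the toric ideal says that the algebra is the direct sum of its components in the
  standard grading.
\<close>
locale toric_algebra = scalar_hom \<iota> for \<iota> :: "'k::field \<Rightarrow> 'r::comm_ring_1" +
  fixes U A :: "'r set"
  assumes algebra_eq: "A = toric_map \<iota> ` mpolys U"
    and kernel_homogeneous:
      "p \<in> mpolys U \<Longrightarrow> toric_map \<iota> p = 0 \<Longrightarrow> toric_map \<iota> (hom_part j p) = 0"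
begin

lemma toric_map_zero [simp]: "toric_map \<iota> 0 = 0"
  and toric_map_add: "toric_map \<iota> (p + q) = toric_map \<iota> p + toric_map \<iota> q"
  and toric_map_diff: "toric_map \<iota> (p - q) = toric_map \<iota> p - toric_map \<iota> q"
  and toric_map_mult: "toric_map \<iota> (p * q) = toric_map \<iota> p * toric_map \<iota> q"
  by (simp_all add: toric_map_eq_eval_at eval_at_add eval_at_diff eval_at_mult)

end

locale resolution = toric_algebra \<iota> U A
  for \<iota> :: "'k::field \<Rightarrow> 'r::comm_ring_1" and U A :: "'r set" +
  fixes B :: "nat \<Rightarrow> nat set" and d :: "nat \<Rightarrow> nat \<Rightarrow> int"
    and D :: "nat \<Rightarrow> (nat \<Rightarrow>\<^sub>0 ('r, 'k) mpoly) \<Rightarrow> (nat \<Rightarrow>\<^sub>0 ('r, 'k) mpoly)"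
    and e :: "(nat \<Rightarrow>\<^sub>0 ('r, 'k) mpoly) \<Rightarrow> 'r"
  assumes res: "graded_free_resolution \<iota> U A B d D e"
begin

lemma finite_degree: "finite {b \<in> B i. d i b = j}"
  using res by (simp add: graded_free_resolution_def)

lemma D_graded: "graded_map (\<lambda>p. p) U (B (Suc i)) (d (Suc i)) U (B i) (d i) (D i)"
  using res by (simp add: graded_free_resolution_def graded_map_def semilinear_def)

lemma e_semilinear: "semilinear (\<lambda>p a. toric_map \<iota> p * a) U (B 0) e"
  using res by (simp add: graded_free_resolution_def semilinear_def)

lemma e_component: "f \<in> free_component U (B 0) (d 0) j \<Longrightarrow> e f \<in> alg_component \<iota> U j"
  using res unfolding graded_free_resolution_def by blast

lemma e_image: "e ` free_mod U (B 0) = A"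
  using res by (simp add: graded_free_resolution_def)

lemma exact_0: "{f \<in> free_mod U (B 0). e f = 0} = D 0 ` free_mod U (B 1)"
  using res unfolding graded_free_resolution_def by blast

lemma exact_Suc: "{f \<in> free_mod U (B (Suc i)). D i f = 0} = D (Suc i) ` free_mod U (B (Suc (Suc i)))"
  using res unfolding graded_free_resolution_def by blast

lemma D_in_free_mod: "f \<in> free_mod U (B (Suc i)) \<Longrightarrow> D i f \<in> free_mod U (B i)"
  using graded_map_in_free_mod[OF D_graded] .

lemma e_D: "f \<in> free_mod U (B 1) \<Longrightarrow> e (D 0 f) = 0"
  using exact_0 by blast

lemma D_D: "f \<in> free_mod U (B (Suc (Suc i))) \<Longrightarrow> D i (D (Suc i) f) = 0"
  using exact_Suc by blast

text \<open>
  Any preimage \<open>y\<close> of the image of \<open>q\<close> can be replaced by its component of degree \<open>j\<close>: the images of the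
  components of \<open>y\<close> are homogeneous and add up to an element of degree \<open>j\<close>, so by homogeneity of the
  toric ideal the component of degree \<open>j\<close> already has that image.
\<close>
lemma homogeneous_augmentation_preimage:
  assumes q: "q \<in> hom_mpolys U j"
  obtains y where "y \<in> free_component U (B 0) (d 0) j" "e y = toric_map \<iota> q"
proof -
  have lift: "\<exists>p\<in>mpolys U. e y = toric_map \<iota> p \<and> (\<forall>i. e (free_part (d 0) i y) = toric_map \<iota> (hom_part i p))"
    if "y \<in> free_mod U (B 0)" for y
    using that
  proof (induction y rule: free_mod_induct)
    case zero
    then show ?case
      using semilinear_zero[OF e_semilinear] by (intro bexI[of _ 0]) simp_all
  next
    case (single b m c)
    let ?i = "int (mdeg m) + d 0 b"
    have mem: "single b (single m c) \<in> free_component U (B 0) (d 0) ?i"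
      using single by (simp add: single_in_free_component single_in_hom_mpolys)
    then obtain p where p: "p \<in> hom_mpolys U ?i" "e (single b (single m c)) = toric_map \<iota> p"
      using e_component unfolding alg_component_def by blast
    then show ?case
      using free_part_component[OF mem] hom_part_hom[OF p(1)] semilinear_zero[OF e_semilinear]
        hom_mpolys_subset[THEN subsetD, OF p(1)]
      by (intro bexI[of _ p]) auto
  next
    case (add f g)
    then obtain p q where "p \<in> mpolys U" "e f = toric_map \<iota> p"
        "\<And>i. e (free_part (d 0) i f) = toric_map \<iota> (hom_part i p)"
        "q \<in> mpolys U" "e g = toric_map \<iota> q"
        "\<And>i. e (free_part (d 0) i g) = toric_map \<iota> (hom_part i q)" by blast
    then show ?case
      using add(1,2) semilinear_add[OF e_semilinear]
      by (intro bexI[of _ "p + q"])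
        (simp_all add: free_part_add free_part_in_free_mod hom_part_add toric_map_add add_in_mpolys)
  qed
  have qU: "q \<in> mpolys U" using q hom_mpolys_subset by blast
  then have "toric_map \<iota> q \<in> e ` free_mod U (B 0)"
    using e_image algebra_eq by blast
  then obtain y where y: "y \<in> free_mod U (B 0)" "toric_map \<iota> q = e y" by blast
  from lift[OF y(1)] obtain p where p: "p \<in> mpolys U" "e y = toric_map \<iota> p"
      "e (free_part (d 0) j y) = toric_map \<iota> (hom_part j p)" by blast
  have "hom_part j (p - q) = hom_part j p - q"
    using hom_part_add[of j "p - q" q] hom_part_hom[OF q, of j] by (simp add: algebra_simps)
  then have "toric_map \<iota> (hom_part j p - q) = 0"
    using kernel_homogeneous[of "p - q" j] p(1,2) y(2) qU by (simp add: toric_map_diff diff_in_mpolys)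
  then have "e (free_part (d 0) j y) = toric_map \<iota> q"
    using p(3) by (simp add: toric_map_diff)
  then show thesis using that free_part_in_free_component[OF y(1)] by blast
qed

lemma e_in_toric_image:
  assumes "f \<in> free_mod U (B 0)"
  obtains p where "p \<in> mpolys U" "e f = toric_map \<iota> p"
  using assms e_image algebra_eq by blast

end

text \<open>
  Level \<open>0\<close> lifts the map that \<open>h\<close> induces on the algebras, and level \<open>i + 1\<close> lifts \<open>\<phi> i \<circ> D i\<close> through
  \<open>D' i\<close>.  Each step is possible because \<open>\<phi> i\<close> maps boundaries to cycles, which are boundaries by
  exactness.
\<close>
theorem comparison:
  fixes \<iota> :: "'k::field \<Rightarrow> 'r::comm_ring_1" and \<iota>' :: "'k \<Rightarrow> 's::comm_ring_1"
  assumes F: "resolution \<iota> U A B d D e" and F': "resolution \<iota>' U' A' B' d' D' e'"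
    and h: "graded_hom U U' h"
    and ker: "\<And>p. p \<in> mpolys U \<Longrightarrow> toric_map \<iota> p = 0 \<Longrightarrow> toric_map \<iota>' (h p) = 0"
  shows "\<exists>\<phi>. (\<forall>i. graded_map h U (B i) (d i) U' (B' i) (d' i) (\<phi> i)) \<and>
    (\<forall>f\<in>free_mod U (B 0). \<forall>p\<in>mpolys U. e f = toric_map \<iota> p \<longrightarrow> e' (\<phi> 0 f) = toric_map \<iota>' (h p)) \<and>
    (\<forall>i. \<forall>f\<in>free_mod U (B (Suc i)). D' i (\<phi> (Suc i) f) = \<phi> i (D i f))"
proof -
  interpret F: resolution \<iota> U A B d D e by fact
  interpret F': resolution \<iota>' U' A' B' d' D' e' by fact
  interpret graded_hom U U' h by fact
  \<comment> \<open>the map of algebras induced by \<open>h\<close>\<close>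
  define \<gamma> where "\<gamma> a = toric_map \<iota>' (h (SOME p. p \<in> mpolys U \<and> toric_map \<iota> p = a))" for a
  have \<gamma>: "\<gamma> (toric_map \<iota> p) = toric_map \<iota>' (h p)" if p: "p \<in> mpolys U" for p
  proof -
    define q where "q = (SOME q. q \<in> mpolys U \<and> toric_map \<iota> q = toric_map \<iota> p)"
    have q: "q \<in> mpolys U \<and> toric_map \<iota> q = toric_map \<iota> p"
      unfolding q_def by (rule someI[of _ p]) (simp add: p)
    have "toric_map \<iota>' (h (q - p)) = 0"
      using ker[of "q - p"] q p by (simp add: F.toric_map_diff diff_in_mpolys)
    moreover have "h (q - p) = h q - h p"
      using hom_add[of "q - p" p] by (simp add: algebra_simps)
    ultimately show ?thesis
      by (simp add: \<gamma>_def q_def[symmetric] F'.toric_map_diff)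
  qed
  have aug_semilinear: "semilinear (\<lambda>p a. toric_map \<iota>' (h p) * a) U (B 0) (\<lambda>f. \<gamma> (e f))"
    unfolding semilinear_def
  proof (intro conjI ballI)
    fix f g :: "nat \<Rightarrow>\<^sub>0 ('r, 'k) mpoly"
    assume fg: "f \<in> free_mod U (B 0)" "g \<in> free_mod U (B 0)"
    then obtain p q where "p \<in> mpolys U" "e f = toric_map \<iota> p" "q \<in> mpolys U" "e g = toric_map \<iota> q"
      using F.e_in_toric_image by metis
    then show "\<gamma> (e (f + g)) = \<gamma> (e f) + \<gamma> (e g)"
      using \<gamma> add_in_mpolys[of p U q] semilinear_add[OF F.e_semilinear fg]
      by (simp add: F.toric_map_add[symmetric] hom_add F'.toric_map_add)
  next
    fix f :: "nat \<Rightarrow>\<^sub>0 ('r, 'k) mpoly" and p :: "('r, 'k) mpoly"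
    assume fp: "p \<in> mpolys U" "f \<in> free_mod U (B 0)"
    then obtain q where "q \<in> mpolys U" "e f = toric_map \<iota> q"
      using F.e_in_toric_image by metis
    then show "\<gamma> (e (smul p f)) = toric_map \<iota>' (h p) * \<gamma> (e f)"
      using \<gamma> fp mult_in_mpolys[of p U q] semilinear_smul[OF F.e_semilinear fp]
      by (simp add: F.toric_map_mult[symmetric] hom_mult F'.toric_map_mult)
  qed
  \<comment> \<open>the second clause is the condition under which \<open>\<phi>\<close> extends one level further\<close>
  define P where "P i \<phi> \<longleftrightarrow> graded_map h U (B i) (d i) U' (B' i) (d' i) \<phi> \<and>
      (\<forall>f\<in>free_mod U (B (Suc i)). \<phi> (D i f) \<in> D' i ` free_mod U' (B' (Suc i))) \<and>
      (i = 0 \<longrightarrow> (\<forall>f\<in>free_mod U (B 0). e' (\<phi> f) = \<gamma> (e f)))" for i \<phi>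
  define Q where "Q i \<phi> \<psi> \<longleftrightarrow> (\<forall>f\<in>free_mod U (B (Suc i)). D' i (\<psi> f) = \<phi> (D i f))" for i \<phi> \<psi>
  have "\<exists>\<phi>. \<forall>i. P i (\<phi> i) \<and> Q i (\<phi> i) (\<phi> (Suc i))"
  proof (rule dependent_nat_choice)
    have "\<exists>y\<in>free_component U' (B' 0) (d' 0) (d 0 b). e' y = \<gamma> (e (single b 1))" if b: "b \<in> B 0" for b
    proof -
      have "e (single b 1) \<in> alg_component \<iota> U (d 0 b)"
        by (intro F.e_component unit_in_free_component b)
      then obtain p where p: "p \<in> hom_mpolys U (d 0 b)" "e (single b 1) = toric_map \<iota> p"
        by (auto simp: alg_component_def)
      show ?thesis
        using F'.homogeneous_augmentation_preimage[OF hom_degree[OF p(1)]] p \<gamma>[of p] hom_mpolys_subset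
        by (metis subsetD)
    qed
    from lifting[OF h aug_semilinear F'.e_semilinear this]
    obtain \<phi> where \<phi>: "graded_map h U (B 0) (d 0) U' (B' 0) (d' 0) \<phi>"
        "\<And>f. f \<in> free_mod U (B 0) \<Longrightarrow> e' (\<phi> f) = \<gamma> (e f)" by blast
    have "\<phi> (D 0 f) \<in> D' 0 ` free_mod U' (B' 1)" if f: "f \<in> free_mod U (B 1)" for f
    proof -
      have "D 0 f \<in> free_mod U (B 0)" using F.D_in_free_mod[of f 0] f by simp
      moreover have "\<gamma> 0 = 0" using \<gamma>[of 0] by simp
      ultimately have "e' (\<phi> (D 0 f)) = 0" "\<phi> (D 0 f) \<in> free_mod U' (B' 0)"
        using \<phi>(2) F.e_D[OF f] graded_map_in_free_mod[OF \<phi>(1)] by simp_all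
      then show ?thesis using F'.exact_0 by blast
    qed
    with \<phi> show "\<exists>\<phi>. P 0 \<phi>" unfolding P_def by auto
  next
    fix \<phi> i assume "P i \<phi>"
    then have \<phi>: "graded_map h U (B i) (d i) U' (B' i) (d' i) \<phi>"
        "\<And>f. f \<in> free_mod U (B (Suc i)) \<Longrightarrow> \<phi> (D i f) \<in> D' i ` free_mod U' (B' (Suc i))"
      by (auto simp: P_def)
    have comp: "graded_map h U (B (Suc i)) (d (Suc i)) U' (B' i) (d' i) (\<lambda>f. \<phi> (D i f))"
      by (rule graded_map_comp[OF graded_hom_id F.D_graded \<phi>(1)])
    have "\<exists>y\<in>free_component U' (B' (Suc i)) (d' (Suc i)) (d (Suc i) b). D' i y = \<phi> (D i (single b 1))"
      if b: "b \<in> B (Suc i)" for b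
      using homogeneous_preimage[OF F'.D_graded
          graded_map_component[OF comp unit_in_free_component[OF b]] \<phi>(2)]
        b single_in_free_mod[OF b, of 1 U] by (metis one_in_mpolys)
    from lifting[OF h graded_map_semilinear[OF comp] graded_map_semilinear[OF F'.D_graded] this]
    obtain \<psi> where \<psi>: "graded_map h U (B (Suc i)) (d (Suc i)) U' (B' (Suc i)) (d' (Suc i)) \<psi>"
        "\<And>f. f \<in> free_mod U (B (Suc i)) \<Longrightarrow> D' i (\<psi> f) = \<phi> (D i f)" by blast
    have "\<psi> (D (Suc i) f) \<in> D' (Suc i) ` free_mod U' (B' (Suc (Suc i)))"
      if f: "f \<in> free_mod U (B (Suc (Suc i)))" for f
    proof -
      have "D' i (\<psi> (D (Suc i) f)) = 0"
        using \<psi>(2)[OF F.D_in_free_mod[OF f]] F.D_D[OF f] graded_map_zero[OF \<phi>(1)] by simp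
      moreover have "\<psi> (D (Suc i) f) \<in> free_mod U' (B' (Suc i))"
        using graded_map_in_free_mod[OF \<psi>(1) F.D_in_free_mod[OF f]] .
      ultimately show ?thesis using F'.exact_Suc[of i] by blast
    qed
    with \<psi> show "\<exists>\<psi>. P (Suc i) \<psi> \<and> Q i \<phi> \<psi>" unfolding P_def Q_def by auto
  qed
  then obtain \<phi> where \<phi>: "\<And>i. P i (\<phi> i)" "\<And>i. Q i (\<phi> i) (\<phi> (Suc i))" by blast
  then show ?thesis
    using \<gamma> by (intro exI[of _ \<phi>]) (auto simp: P_def Q_def)
qed

context resolution
begin

text \<open>
  A chain endomorphism \<open>\<delta>\<close> that induces zero on the algebra takes values in boundaries at level \<open>0\<close>, so
  it lifts through \<open>D 0\<close> to \<open>s 0\<close>.  At level \<open>i + 1\<close> the map \<open>\<delta> (i + 1) - s i \<circ> D i\<close> takes values in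
  cycles, hence in boundaries, and lifts in the same way.
\<close>
theorem null_homotopy:
  assumes \<delta>: "\<And>i. graded_map (\<lambda>p. p) U (B i) (d i) U (B i) (d i) (\<delta> i)"
    and aug: "\<And>f. f \<in> free_mod U (B 0) \<Longrightarrow> e (\<delta> 0 f) = 0"
    and chain: "\<And>i f. f \<in> free_mod U (B (Suc i)) \<Longrightarrow> D i (\<delta> (Suc i) f) = \<delta> i (D i f)"
  shows "\<exists>s. (\<forall>i. graded_map (\<lambda>p. p) U (B i) (d i) U (B (Suc i)) (d (Suc i)) (s i)) \<and>
    (\<forall>f\<in>free_mod U (B 0). D 0 (s 0 f) = \<delta> 0 f) \<and>
    (\<forall>i. \<forall>f\<in>free_mod U (B (Suc i)). D (Suc i) (s (Suc i) f) = \<delta> (Suc i) f - s i (D i f))"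
proof -
  \<comment> \<open>the second clause makes the next map to be lifted take values in cycles\<close>
  define P where "P i s \<longleftrightarrow> graded_map (\<lambda>p. p) U (B i) (d i) U (B (Suc i)) (d (Suc i)) s \<and>
      (\<forall>f\<in>free_mod U (B (Suc i)). D i (\<delta> (Suc i) f - s (D i f)) = 0) \<and>
      (i = 0 \<longrightarrow> (\<forall>f\<in>free_mod U (B 0). D 0 (s f) = \<delta> 0 f))" for i s
  define Q where "Q i s t \<longleftrightarrow> (\<forall>f\<in>free_mod U (B (Suc i)). D (Suc i) (t f) = \<delta> (Suc i) f - s (D i f))" for i s t
  have lift: "\<exists>s. graded_map (\<lambda>p. p) U (B i) (d i) U (B (Suc i)) (d (Suc i)) s \<and>
      (\<forall>f\<in>free_mod U (B i). D i (s f) = g f)"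
    if g: "graded_map (\<lambda>p. p) U (B i) (d i) U (B i) (d i) g"
      and im: "\<And>f. f \<in> free_mod U (B i) \<Longrightarrow> g f \<in> D i ` free_mod U (B (Suc i))" for i g
  proof (rule lifting[OF graded_hom_id graded_map_semilinear[OF g] graded_map_semilinear[OF D_graded]])
    fix b assume b: "b \<in> B i"
    then show "\<exists>y\<in>free_component U (B (Suc i)) (d (Suc i)) (d i b). D i y = g (single b 1)"
      using homogeneous_preimage[OF D_graded graded_map_component[OF g unit_in_free_component[OF b]] im]
      by (metis single_in_free_mod one_in_mpolys)
  qed
  have "\<exists>s. \<forall>i. P i (s i) \<and> Q i (s i) (s (Suc i))"
  proof (rule dependent_nat_choice)
    have "\<delta> 0 f \<in> D 0 ` free_mod U (B 1)" if "f \<in> free_mod U (B 0)" for f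
      using aug[OF that] graded_map_in_free_mod[OF \<delta> that] exact_0 by blast
    then obtain s where s: "graded_map (\<lambda>p. p) U (B 0) (d 0) U (B 1) (d 1) s"
        "\<And>f. f \<in> free_mod U (B 0) \<Longrightarrow> D 0 (s f) = \<delta> 0 f"
      using lift[OF \<delta>[of 0]] by auto
    have "D 0 (\<delta> 1 f - s (D 0 f)) = 0" if f: "f \<in> free_mod U (B 1)" for f
    proof -
      have Df: "D 0 f \<in> free_mod U (B 0)" using D_in_free_mod[of f 0] f by simp
      have "\<delta> 1 f \<in> free_mod U (B (Suc 0))" "s (D 0 f) \<in> free_mod U (B (Suc 0))"
        using graded_map_in_free_mod[OF \<delta>[of 1] f] graded_map_in_free_mod[OF s(1) Df] by simp_all
      then show ?thesis
        using graded_map_diff[OF D_graded[of 0]] chain[of f 0] f s(2)[OF Df] by simp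
    qed
    with s show "\<exists>s. P 0 s" unfolding P_def by auto
  next
    fix s i assume "P i s"
    then have s: "graded_map (\<lambda>p. p) U (B i) (d i) U (B (Suc i)) (d (Suc i)) s"
        "\<And>f. f \<in> free_mod U (B (Suc i)) \<Longrightarrow> D i (\<delta> (Suc i) f - s (D i f)) = 0"
      by (auto simp: P_def)
    define g where "g f = \<delta> (Suc i) f - s (D i f)" for f
    have g: "graded_map (\<lambda>p. p) U (B (Suc i)) (d (Suc i)) U (B (Suc i)) (d (Suc i)) g"
      unfolding g_def by (intro graded_map_minus \<delta> graded_map_comp[OF graded_hom_id D_graded s(1)])
    have "g f \<in> D (Suc i) ` free_mod U (B (Suc (Suc i)))" if "f \<in> free_mod U (B (Suc i))" for f
      using s(2)[OF that] graded_map_in_free_mod[OF g that] exact_Suc[of i] unfolding g_def by blast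
    then obtain t where t: "graded_map (\<lambda>p. p) U (B (Suc i)) (d (Suc i)) U (B (Suc (Suc i))) (d (Suc (Suc i))) t"
        "\<And>f. f \<in> free_mod U (B (Suc i)) \<Longrightarrow> D (Suc i) (t f) = g f"
      using lift[OF g] by blast
    have "D (Suc i) (\<delta> (Suc (Suc i)) f - t (D (Suc i) f)) = 0"
      if f: "f \<in> free_mod U (B (Suc (Suc i)))" for f
    proof -
      note Df = D_in_free_mod[OF f]
      have "D (Suc i) (t (D (Suc i) f)) = \<delta> (Suc i) (D (Suc i) f)"
        using t(2)[OF Df] D_D[OF f] graded_map_zero[OF s(1)] by (simp add: g_def)
      then show ?thesis
        using graded_map_diff[OF D_graded, OF graded_map_in_free_mod[OF \<delta> f] graded_map_in_free_mod[OF t(1) Df]]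
          chain[OF f] by simp
    qed
    with t show "\<exists>t. P (Suc i) t \<and> Q i s t" unfolding P_def Q_def g_def by auto
  qed
  then obtain s where "\<And>i. P i (s i)" "\<And>i. Q i (s i) (s (Suc i))" by blast
  then show ?thesis by (intro exI[of _ s]) (auto simp: P_def Q_def)
qed

end

section \<open>Functoriality of Tor and algebra retracts\<close>

context vector_space
begin

text \<open>
  The hypotheses on \<open>f\<close> say that it induces an injective map from \<open>Z' / W'\<close> to \<open>Z / W\<close>.  Concretely,
  extend a basis \<open>X'\<close> of \<open>W'\<close> to a basis \<open>Y\<close> of \<open>Z'\<close>; then the images of \<open>Y - X'\<close> are independent modulo \<open>W\<close>,
  so together with a basis of \<open>W\<close> they form an independent subset of \<open>Z\<close>.
\<close>
lemma quotient_dim_le: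
  assumes sub: "subspace Z" "subspace W" "subspace Z'" "subspace W'" "W \<subseteq> Z" "W' \<subseteq> Z'"
    and fin: "finite T" "Z \<subseteq> span T" "finite T'" "Z' \<subseteq> span T'"
    and f: "\<And>v. v \<in> Z' \<Longrightarrow> f v \<in> Z"
    and add: "\<And>v w. v \<in> Z' \<Longrightarrow> w \<in> Z' \<Longrightarrow> f (v + w) = f v + f w"
    and scale: "\<And>c v. v \<in> Z' \<Longrightarrow> f (scale c v) = scale c (f v)"
    and ker: "\<And>v. v \<in> Z' \<Longrightarrow> f v \<in> W \<Longrightarrow> v \<in> W'"
  shows "dim Z' - dim W' \<le> dim Z - dim W"
proof -
  obtain X where X: "X \<subseteq> W" "independent X" "W \<subseteq> span X" "card X = dim W"
    using basis_exists by blast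
  obtain X' where X': "X' \<subseteq> W'" "independent X'" "W' \<subseteq> span X'" "card X' = dim W'"
    using basis_exists by blast
  obtain Y where Y: "X' \<subseteq> Y" "Y \<subseteq> Z'" "independent Y" "Z' \<subseteq> span Y"
    using maximal_independent_subset_extend[of X' Z'] X' sub(6) by blast
  have finY: "finite Y"
    using independent_span_bound[OF fin(3) Y(3)] Y(2) fin(4) by blast
  have dimZ': "card Y = dim Z'"
    by (rule basis_card_eq_dim[OF Y(2,4,3)])
  have spanX: "span X = W" using X sub(2) span_subspace by blast
  have spanX': "span X' = W'" using X' sub(4) span_subspace by blast
  have f_minus: "f (v - w) = f v - f w" if "v \<in> Z'" "w \<in> Z'" for v w
    using add[of "v - w" w] subspace_diff[OF sub(3)] that by simp
  have f0: "f 0 = 0" using f_minus[of 0 0] subspace_0[OF sub(3)] by simp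
  have finX: "finite X"
    using independent_span_bound[OF fin(1) X(2)] X(1) sub(5) fin(2) by blast
  have "independent (X \<union> f ` S) \<and> card (X \<union> f ` S) = card X + card S"
    if "finite S" "S \<subseteq> Y - X'" for S
    using that
  proof (induction S rule: finite_induct)
    case empty
    then show ?case using X by simp
  next
    case (insert s S)
    have SZ': "span S \<subseteq> Z'" using insert.prems Y(2) by (intro span_minimal sub(3)) auto
    have sZ': "s \<in> Z'" using insert.prems Y(2) by auto
    \<comment> \<open>the span is described as a sum because \<open>f\<close> is linear on \<open>Z'\<close> only\<close>
    let ?V = "{x + f t | x t. x \<in> W \<and> t \<in> span S}"
    have new: "f s \<notin> span (X \<union> f ` S)"
    proof
      have "subspace ?V"
      proof (rule subspaceI)
        show "0 \<in> ?V"
          using subspace_0[OF sub(2)] span_zero[of S] f0 by (intro CollectI exI[of _ 0] conjI) simp_all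
      next
        fix a b assume "a \<in> ?V" "b \<in> ?V"
        then obtain x t y u where "a = x + f t" "b = y + f u" "x \<in> W" "y \<in> W" "t \<in> span S" "u \<in> span S"
          by blast
        then have "a + b = (x + y) + f (t + u)" "x + y \<in> W" "t + u \<in> span S"
          using add[of t u] subsetD[OF SZ', of t] subsetD[OF SZ', of u]
            subspace_add[OF sub(2)] span_add[of t S u] by (simp_all add: algebra_simps)
        then show "a + b \<in> ?V" by blast
      next
        fix c a assume "a \<in> ?V"
        then obtain x t where "a = x + f t" "x \<in> W" "t \<in> span S" by blast
        then have "scale c a = scale c x + f (scale c t)" "scale c x \<in> W" "scale c t \<in> span S"
          using scale[of t c] subsetD[OF SZ', of t] subspace_scale[OF sub(2)] span_scale[of t S c]
          by (simp_all add: scale_right_distrib)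
        then show "scale c a \<in> ?V" by blast
      qed
      moreover have "X \<union> f ` S \<subseteq> ?V"
      proof
        fix v assume "v \<in> X \<union> f ` S"
        then consider "v \<in> W" | t where "t \<in> S" "v = f t" using X(1) by blast
        then show "v \<in> ?V"
        proof cases
          case 1
          then have "v = v + f 0" "v \<in> W" "0 \<in> span S" by (simp_all add: f0 span_zero)
          then show ?thesis by blast
        next
          case 2
          then have "v = 0 + f t" "0 \<in> W" "t \<in> span S"
            by (simp_all add: subspace_0[OF sub(2)] span_base)
          then show ?thesis by blast
        qed
      qed
      ultimately have "span (X \<union> f ` S) \<subseteq> ?V" by (rule span_minimal[rotated])
      moreover assume "f s \<in> span (X \<union> f ` S)"
      ultimately obtain x t where xt: "f s = x + f t" "x \<in> W" "t \<in> span S" by blast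
      then have t: "t \<in> Z'" using SZ' by blast
      have "f (s - t) \<in> W" using f_minus[OF sZ' t] xt by simp
      then have "s - t \<in> span X'"
        using ker[OF subspace_diff[OF sub(3) sZ' t]] spanX' by simp
      then have "(s - t) + t \<in> span (X' \<union> S)"
        using xt(3) span_mono[of X' "X' \<union> S"] span_mono[of S "X' \<union> S"] by (intro span_add) auto
      moreover have "X' \<union> S \<subseteq> Y - {s}" using insert.hyps insert.prems Y(1) by auto
      ultimately have "s \<in> span (Y - {s})" using span_mono[of "X' \<union> S" "Y - {s}"] by auto
      then show False using Y(3) insert.prems unfolding dependent_def by blast
    qed
    have IH: "independent (X \<union> f ` S)" "card (X \<union> f ` S) = card X + card S"
      using insert.IH insert.prems by auto
    have "independent (insert (f s) (X \<union> f ` S))" "f s \<notin> X \<union> f ` S"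
      using independent_insertI[OF new IH(1)] new span_base[of "f s" "X \<union> f ` S"]
      by (simp, blast)
    then show ?case using IH insert.hyps finX by simp
  qed
  from this[of "Y - X'"] finY
  have ind: "independent (X \<union> f ` (Y - X'))" and
    card: "card (X \<union> f ` (Y - X')) = card X + card (Y - X')" by simp_all
  obtain R where R: "R \<subseteq> Z" "independent R" "Z \<subseteq> span R" "card R = dim Z"
    using basis_exists by blast
  have "finite R" using independent_span_bound[OF fin(1) R(2)] R(1) fin(2) by blast
  moreover have "X \<union> f ` (Y - X') \<subseteq> Z" using X(1) sub(5) Y(2) f by blast
  ultimately have "card (X \<union> f ` (Y - X')) \<le> dim Z"
    using independent_span_bound[of R, OF _ ind] subset_trans[OF _ R(3)] R(4) by simp
  moreover have "card (Y - X') = dim Z' - dim W'"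
    using card_Diff_subset[of X' Y] finite_subset[OF Y(1) finY] Y(1) dimZ' X'(4) by simp
  ultimately show ?thesis using card X(4) by simp
qed

end

interpretation coefficients: vector_space "smul :: 'k::field \<Rightarrow> ('b \<Rightarrow>\<^sub>0 'k) \<Rightarrow> ('b \<Rightarrow>\<^sub>0 'k)"
  by standard (simp_all add: smul_add_right smul_add_left smul_smul)

definition constant_part :: "('b \<Rightarrow>\<^sub>0 ('v, 'k::field) mpoly) \<Rightarrow> ('b \<Rightarrow>\<^sub>0 'k)" where
  "constant_part = Poly_Mapping.map (\<lambda>p. lookup p 0)"

definition constant_vector :: "('b \<Rightarrow>\<^sub>0 'k::field) \<Rightarrow> ('b \<Rightarrow>\<^sub>0 ('v, 'k) mpoly)" where
  "constant_vector = Poly_Mapping.map mconst"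

text \<open>
  The map induced on tensor products with \<open>K\<close>, as in \<open>tensor_map\<close>, but between free modules over
  polynomial rings that may have variables of different types.
\<close>
definition reduction ::
    "(('b \<Rightarrow>\<^sub>0 ('v, 'k::field) mpoly) \<Rightarrow> ('c \<Rightarrow>\<^sub>0 ('w, 'k) mpoly)) \<Rightarrow> ('b \<Rightarrow>\<^sub>0 'k) \<Rightarrow> ('c \<Rightarrow>\<^sub>0 'k)" where
  "reduction \<phi> v = constant_part (\<phi> (constant_vector v))"

lemma tensor_map_eq_reduction: "tensor_map = reduction"
  by (intro ext) (simp add: tensor_map_def reduction_def constant_part_def constant_vector_def)

lemmas tor_cycles_eq = tor_cycles_def[unfolded tensor_map_eq_reduction]
  and tor_boundaries_eq = tor_boundaries_def[unfolded tensor_map_eq_reduction]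

lemma lookup_constant_part: "lookup (constant_part f) b = lookup (lookup f b) 0"
  by (simp add: constant_part_def lookup_map_zero)

lemma lookup_constant_vector: "lookup (constant_vector v) b = mconst (lookup v b)"
  by (simp add: constant_vector_def lookup_map_zero)

lemma constant_part_zero [simp]: "constant_part 0 = 0"
  and constant_part_add: "constant_part (f + g) = constant_part f + constant_part g"
  and constant_part_diff: "constant_part (f - g) = constant_part f - constant_part g"
  by (auto intro!: poly_mapping_eqI simp: lookup_constant_part lookup_add lookup_minus)

lemma constant_vector_zero [simp]: "constant_vector 0 = 0"
  and constant_vector_add: "constant_vector (v + w) = constant_vector v + constant_vector w"
  and constant_vector_smul: "constant_vector (smul c v) = smul (mconst c) (constant_vector v)"
  by (auto intro!: poly_mapping_eqI simp: lookup_constant_vector lookup_add lookup_smul mconst_add mconst_mult)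

lemma constant_vector_part: "constant_part (constant_vector v) = v"
  by (rule poly_mapping_eqI) (simp add: lookup_constant_part lookup_constant_vector mconst_def)

lemma constant_term_mult:
  fixes p q :: "('v, 'k::comm_ring_1) mpoly"
  shows "lookup (p * q) 0 = lookup p 0 * lookup q 0"
proof (induction p rule: poly_mapping_add_induct)
  case (single m c)
  have sum_0: "m + m' = 0 \<longleftrightarrow> m = 0 \<and> m' = 0" for m' :: "'v \<Rightarrow>\<^sub>0 nat"
    by (simp add: mdeg_eq_0_iff[symmetric] mdeg_add)
  show ?case
    by (induction q rule: poly_mapping_add_induct)
      (auto simp: mult_single lookup_single when_def sum_0 distrib_left lookup_add)
qed (simp_all add: distrib_right lookup_add)

lemma constant_part_smul: "constant_part (smul p f) = smul (lookup p 0) (constant_part f)"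
  by (rule poly_mapping_eqI) (simp add: lookup_constant_part lookup_smul constant_term_mult)

lemma keys_subset_iff: "keys f \<subseteq> S \<longleftrightarrow> (\<forall>k. k \<notin> S \<longrightarrow> lookup f k = 0)"
  by (auto simp: in_keys_iff)

lemma constant_vector_in_free_mod: "keys v \<subseteq> B \<Longrightarrow> constant_vector v \<in> free_mod V B"
  by (simp add: free_mod_def lookup_constant_vector keys_subset_iff)

lemma constant_part_keys: "f \<in> free_mod V B \<Longrightarrow> keys (constant_part f) \<subseteq> B"
  by (simp add: free_mod_def lookup_constant_part keys_subset_iff)

lemma tensor_component_keys: "v \<in> tensor_component B d j \<Longrightarrow> keys v \<subseteq> B"
  by (auto simp: tensor_component_def)

lemma constant_vector_component:
  assumes "v \<in> tensor_component B d j"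
  shows "constant_vector v \<in> free_component V B d j"
proof -
  have "mconst (lookup v b) \<in> hom_mpolys V (j - d b)" for b
    using assms by (cases "lookup v b = 0") (auto simp: tensor_component_def in_keys_iff)
  then show ?thesis
    using constant_vector_in_free_mod[OF tensor_component_keys[OF assms]]
    by (simp add: free_component_def lookup_constant_vector)
qed

lemma constant_part_component:
  assumes "f \<in> free_component V B d j"
  shows "constant_part f \<in> tensor_component B d j"
proof -
  have "d b = j" if "lookup (lookup f b) 0 \<noteq> 0" for b
  proof -
    have "lookup f b \<in> hom_mpolys V (j - d b)" "0 \<in> keys (lookup f b)"
      using assms that by (auto simp: free_component_def in_keys_iff)
    then show ?thesis by (auto simp: hom_mpolys_def)
  qed
  then show ?thesis
    using assms constant_part_keys[of f V B]
    by (auto simp: free_component_def tensor_component_def lookup_constant_part in_keys_iff)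
qed

text \<open>
  The constant part of \<open>\<phi> f\<close> depends only on the constant part of \<open>f\<close>: the other terms of \<open>f\<close> have
  coefficients in the irrelevant ideal, which the ring homomorphism preserves.
\<close>
lemma constant_part_graded_map:
  assumes h: "graded_hom U U' h" and \<phi>: "graded_map h U B d U' B' d' \<phi>" and f: "f \<in> free_mod U B"
  shows "constant_part (\<phi> f) = reduction \<phi> (constant_part f)"
  using f
proof (induction f rule: free_mod_induct)
  case zero
  then show ?case by (simp add: reduction_def graded_map_zero[OF \<phi>])
next
  case (single b m c)
  show ?case
  proof (cases "m = 0")
    case True
    then have "constant_vector (constant_part (single b (single m c))) = single b (single m c)"
      by (intro poly_mapping_eqI[of "constant_vector _"])
        (simp add: lookup_constant_vector lookup_constant_part lookup_single when_def mconst_def)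
    then show ?thesis by (simp add: reduction_def)
  next
    case False
    then have 0: "constant_part (single b (single m c)) = 0"
      by (intro poly_mapping_eqI) (auto simp: lookup_constant_part lookup_single when_def)
    have p: "single m c \<in> mpolys U" using single by (simp add: single_in_mpolys)
    have "\<phi> (single b (single m c)) = smul (h (single m c)) (\<phi> (single b 1))"
      using graded_map_smul[OF \<phi> p single_in_free_mod[OF single(1) one_in_mpolys]]
      by (simp add: smul_single)
    moreover have "lookup (h (single m c)) 0 = 0"
      using graded_hom.hom_constant_term[OF h p] False by (simp add: lookup_single)
    ultimately show ?thesis
      using 0 by (simp add: constant_part_smul reduction_def graded_map_zero[OF \<phi>])
  qed
next
  case (add f g)
  have *: "constant_vector (constant_part f') \<in> free_mod U B" if "f' \<in> free_mod U B" for f'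
    by (intro constant_vector_in_free_mod constant_part_keys[OF that])
  show ?case
    using add(3,4) graded_map_add[OF \<phi> add(1,2)] graded_map_add[OF \<phi> *[OF add(1)] *[OF add(2)]]
    by (simp add: constant_part_add reduction_def constant_vector_add)
qed

text \<open>
  The right-hand side involves only the composite, so two factorizations of the same map can be
  exchanged after reduction.
\<close>
lemma reduction_comp:
  assumes "graded_hom U' U'' h" "graded_map h U' B' d' U'' B'' d'' \<psi>"
    and "graded_map h' U B d U' B' d' \<phi>" "keys v \<subseteq> B"
  shows "reduction \<psi> (reduction \<phi> v) = constant_part (\<psi> (\<phi> (constant_vector v)))"
  using constant_part_graded_map[OF assms(1,2) graded_map_in_free_mod[OF assms(3)
        constant_vector_in_free_mod[OF assms(4)]]]
  by (simp add: reduction_def[of \<phi>])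

lemma reduction_add:
  assumes "graded_map h U B d U' B' d' \<phi>" "keys v \<subseteq> B" "keys w \<subseteq> B"
  shows "reduction \<phi> (v + w) = reduction \<phi> v + reduction \<phi> w"
  using graded_map_add[OF assms(1) constant_vector_in_free_mod[OF assms(2)]
      constant_vector_in_free_mod[OF assms(3)]]
  by (simp add: reduction_def constant_vector_add constant_part_add)

lemma reduction_smul:
  fixes \<phi> :: "('b \<Rightarrow>\<^sub>0 ('v, 'k::field) mpoly) \<Rightarrow> ('c \<Rightarrow>\<^sub>0 ('w, 'k) mpoly)"
  assumes "graded_hom U U' h" "graded_map h U B d U' B' d' \<phi>" "keys v \<subseteq> B"
  shows "reduction \<phi> (smul c v) = smul c (reduction \<phi> v)"
proof -
  have "lookup (mconst c :: ('w, 'k) mpoly) 0 = c" by (simp add: mconst_def)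
  moreover have "h (mconst c) = mconst c" using assms(1) by (rule graded_hom.hom_mconst)
  ultimately show ?thesis
    using graded_map_smul[OF assms(2) mconst_in_mpolys constant_vector_in_free_mod[OF assms(3)], of c]
    by (simp add: reduction_def constant_vector_smul constant_part_smul)
qed

lemma reduction_zero: "graded_map h U B d U' B' d' \<phi> \<Longrightarrow> reduction \<phi> 0 = 0"
  by (simp add: reduction_def graded_map_zero)

lemma reduction_component:
  "graded_map h U B d U' B' d' \<phi> \<Longrightarrow> v \<in> tensor_component B d j \<Longrightarrow> reduction \<phi> v \<in> tensor_component B' d' j"
  unfolding reduction_def
  by (rule constant_part_component[OF graded_map_component[OF _ constant_vector_component]])

lemma tensor_component_subspace: "coefficients.subspace (tensor_component B d j)"
  by (rule coefficients.subspaceI)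
    (simp_all add: tensor_component_def keys_subset_iff lookup_smul lookup_add)

lemma tensor_component_span:
  fixes B :: "'b set"
  shows "(tensor_component B d j :: ('b \<Rightarrow>\<^sub>0 'k::field) set) \<subseteq> coefficients.span ((\<lambda>b. single b 1) ` {b \<in> B. d b = j})"
proof
  fix v :: "'b \<Rightarrow>\<^sub>0 'k" assume v: "v \<in> tensor_component B d j"
  show "v \<in> coefficients.span ((\<lambda>b. single b 1) ` {b \<in> B. d b = j})"
  proof (rule poly_mapping_keys_induct[where R = "\<lambda>b c. b \<in> B \<and> d b = j"])
    fix b and c :: 'k assume "b \<in> B \<and> d b = j"
    then have "smul c (single b 1) \<in> coefficients.span ((\<lambda>b. single b 1) ` {b \<in> B. d b = j})"
      by (intro coefficients.span_scale coefficients.span_base) auto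
    then show "single b c \<in> coefficients.span ((\<lambda>b. single b 1) ` {b \<in> B. d b = j})"
      by (simp add: smul_single)
  next
    show "b \<in> B \<and> d b = j" if "b \<in> keys v" for b
      using v that unfolding tensor_component_def by blast
  qed (rule coefficients.span_zero, rule coefficients.span_add)
qed

context resolution
begin

lemma tor_cycles_subspace: "coefficients.subspace (tor_cycles B d D i j)"
proof (cases i)
  case 0
  then show ?thesis using tensor_component_subspace by (simp add: tor_cycles_eq)
next
  case (Suc k)
  let ?Z = "{v \<in> tensor_component (B i) (d i) j. case i of 0 \<Rightarrow> True | Suc k \<Rightarrow> reduction (D k) v = 0}"
  note sub = tensor_component_subspace[of "B i" "d i" j]
  note T = reduction_zero[OF D_graded] reduction_add[OF D_graded] reduction_smul[OF graded_hom_id D_graded]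
  show ?thesis
    unfolding tor_cycles_eq
  proof (rule coefficients.subspaceI)
    show "0 \<in> ?Z"
      using coefficients.subspace_0[OF sub] T(1) Suc by simp
  next
    fix v w
    assume "v \<in> ?Z"
      and "w \<in> ?Z"
    then show "v + w \<in> ?Z"
      using coefficients.subspace_add[OF sub, of v w] T(2)[of v k w] Suc
        tensor_component_keys[of v "B i" "d i" j] tensor_component_keys[of w "B i" "d i" j] by simp
  next
    fix c v
    assume "v \<in> ?Z"
    then show "smul c v \<in> ?Z"
      using coefficients.subspace_scale[OF sub, of v c] T(3)[of v k c] Suc
        tensor_component_keys[of v "B i" "d i" j] by simp
  qed
qed

lemma tor_boundaries_subspace: "coefficients.subspace (tor_boundaries B d D i j)"
proof -
  let ?W = "reduction (D i) ` tensor_component (B (Suc i)) (d (Suc i)) j"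
  note sub = tensor_component_subspace[of "B (Suc i)" "d (Suc i)" j]
  note T = reduction_zero[OF D_graded] reduction_add[OF D_graded] reduction_smul[OF graded_hom_id D_graded]
  show ?thesis
    unfolding tor_boundaries_eq
  proof (rule coefficients.subspaceI)
    show "0 \<in> ?W"
      using coefficients.subspace_0[OF sub] T(1)[of i] by (metis imageI)
  next
    fix x y assume "x \<in> ?W"
      "y \<in> ?W"
    then obtain v w where "x = reduction (D i) v" "y = reduction (D i) w"
      and vw: "v \<in> tensor_component (B (Suc i)) (d (Suc i)) j" "w \<in> tensor_component (B (Suc i)) (d (Suc i)) j"
      by blast
    then have "x + y = reduction (D i) (v + w)" using T(2) tensor_component_keys by metis
    then show "x + y \<in> ?W"
      using coefficients.subspace_add[OF sub vw] by blast
  next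
    fix x c assume "x \<in> ?W"
    then obtain v where "x = reduction (D i) v" and v: "v \<in> tensor_component (B (Suc i)) (d (Suc i)) j"
      by blast
    then have "smul c x = reduction (D i) (smul c v)" using T(3) tensor_component_keys by metis
    then show "smul c x \<in> ?W"
      using coefficients.subspace_scale[OF sub v] by blast
  qed
qed

lemma tor_boundaries_subset: "tor_boundaries B d D i j \<subseteq> tor_cycles B d D i j"
proof
  fix x assume "x \<in> tor_boundaries B d D i j"
  then obtain v where v: "v \<in> tensor_component (B (Suc i)) (d (Suc i)) j" "x = reduction (D i) v"
    by (auto simp: tor_boundaries_eq)
  have "reduction (D k) x = 0" if "i = Suc k" for k
    using reduction_comp[OF graded_hom_id D_graded D_graded tensor_component_keys, of v]
      v that D_D[OF constant_vector_in_free_mod[OF tensor_component_keys]] by simp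
  then show "x \<in> tor_cycles B d D i j"
    using reduction_component[OF D_graded v(1)] v(2) by (auto simp: tor_cycles_eq split: nat.split)
qed

lemma tor_cycles_span:
  "finite ((\<lambda>b. single b 1) ` {b \<in> B i. d i b = j})"
  "tor_cycles B d D i j \<subseteq> coefficients.span ((\<lambda>b. single b 1) ` {b \<in> B i. d i b = j})"
proof -
  have "tor_cycles B d D i j \<subseteq> tensor_component (B i) (d i) j" by (auto simp: tor_cycles_def)
  then show "tor_cycles B d D i j \<subseteq> coefficients.span ((\<lambda>b. single b 1) ` {b \<in> B i. d i b = j})"
    using tensor_component_span by (rule subset_trans)
qed (simp add: finite_degree)

end

text \<open>
  The chain maps \<open>\<phi>\<close> over \<open>\<eta>\<close> and \<open>\<psi>\<close> over \<open>\<rho>\<close> compose to a chain endomorphism \<open>\<psi> \<circ> \<phi>\<close> of the resolution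
  \<open>F'\<close> that is homotopic to the identity.  Hence \<open>\<phi>\<close> is injective on the homology of \<open>F' \<otimes> K\<close>: if the image
  of a cycle bounds, then so does its image under \<open>\<psi> \<circ> \<phi>\<close>, which differs from the cycle by a boundary.
\<close>
theorem tor_dim_retract:
  fixes \<iota> :: "'k::field \<Rightarrow> 'r::comm_ring_1" and \<iota>' :: "'k \<Rightarrow> 's::comm_ring_1"
  assumes F: "resolution \<iota> U A B d D e" and F': "resolution \<iota>' U' A' B' d' D' e'"
    and \<eta>: "graded_hom U' U \<eta>" and \<rho>: "graded_hom U U' \<rho>"
    and retract: "\<And>p. p \<in> mpolys U' \<Longrightarrow> \<rho> (\<eta> p) = p"
    and ker_\<eta>: "\<And>p. p \<in> mpolys U' \<Longrightarrow> toric_map \<iota>' p = 0 \<Longrightarrow> toric_map \<iota> (\<eta> p) = 0"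
    and ker_\<rho>: "\<And>p. p \<in> mpolys U \<Longrightarrow> toric_map \<iota> p = 0 \<Longrightarrow> toric_map \<iota>' (\<rho> p) = 0"
  shows "tor_dim B' d' D' i j \<le> tor_dim B d D i j"
proof -
  interpret F: resolution \<iota> U A B d D e by fact
  interpret F': resolution \<iota>' U' A' B' d' D' e' by fact
  obtain \<phi> where \<phi>: "\<And>i. graded_map \<eta> U' (B' i) (d' i) U (B i) (d i) (\<phi> i)"
      "\<And>f p. f \<in> free_mod U' (B' 0) \<Longrightarrow> p \<in> mpolys U' \<Longrightarrow> e' f = toric_map \<iota>' p \<Longrightarrow>
         e (\<phi> 0 f) = toric_map \<iota> (\<eta> p)"
      "\<And>i f. f \<in> free_mod U' (B' (Suc i)) \<Longrightarrow> D i (\<phi> (Suc i) f) = \<phi> i (D' i f)"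
    using comparison[OF F' F \<eta> ker_\<eta>] by blast
  obtain \<psi> where \<psi>: "\<And>i. graded_map \<rho> U (B i) (d i) U' (B' i) (d' i) (\<psi> i)"
      "\<And>f p. f \<in> free_mod U (B 0) \<Longrightarrow> p \<in> mpolys U \<Longrightarrow> e f = toric_map \<iota> p \<Longrightarrow>
         e' (\<psi> 0 f) = toric_map \<iota>' (\<rho> p)"
      "\<And>i f. f \<in> free_mod U (B (Suc i)) \<Longrightarrow> D' i (\<psi> (Suc i) f) = \<psi> i (D i f)"
    using comparison[OF F F' \<rho> ker_\<rho>] by blast
  note \<phi>_in = graded_map_in_free_mod[OF \<phi>(1)] and \<psi>_in = graded_map_in_free_mod[OF \<psi>(1)]
  define \<delta> where "\<delta> i f = \<psi> i (\<phi> i f) - f" for i f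
  have \<psi>\<phi>: "graded_map (\<lambda>p. p) U' (B' i) (d' i) U' (B' i) (d' i) (\<lambda>f. \<psi> i (\<phi> i f))" for i
    using graded_map_comp[OF \<eta> \<phi>(1) \<psi>(1)] retract by (simp add: graded_map_def semilinear_def)
  have \<delta>: "graded_map (\<lambda>p. p) U' (B' i) (d' i) U' (B' i) (d' i) (\<delta> i)" for i
    unfolding \<delta>_def by (intro graded_map_minus \<psi>\<phi> graded_map_id)
  have aug: "e' (\<delta> 0 f) = 0" if f: "f \<in> free_mod U' (B' 0)" for f
  proof -
    obtain p where p: "p \<in> mpolys U'" "e' f = toric_map \<iota>' p"
      using F'.e_in_toric_image[OF f] by blast
    have "e' (\<psi> 0 (\<phi> 0 f)) = toric_map \<iota>' (\<rho> (\<eta> p))"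
      by (intro \<psi>(2) \<phi>(2) \<phi>_in f p graded_hom.hom_in_mpolys[OF \<eta>])
    then show ?thesis
      using semilinear_diff[OF F'.e_semilinear \<psi>_in[OF \<phi>_in[OF f]] f] p retract by (simp add: \<delta>_def)
  qed
  have chain: "D' i (\<delta> (Suc i) f) = \<delta> i (D' i f)" if f: "f \<in> free_mod U' (B' (Suc i))" for i f
    using graded_map_diff[OF F'.D_graded \<psi>_in[OF \<phi>_in[OF f]] f] \<phi>(3)[OF f] \<psi>(3)[OF \<phi>_in[OF f]]
    by (simp add: \<delta>_def)
  obtain s where s: "\<And>i. graded_map (\<lambda>p. p) U' (B' i) (d' i) U' (B' (Suc i)) (d' (Suc i)) (s i)"
      "\<And>f. f \<in> free_mod U' (B' 0) \<Longrightarrow> D' 0 (s 0 f) = \<delta> 0 f"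
      "\<And>i f. f \<in> free_mod U' (B' (Suc i)) \<Longrightarrow> D' (Suc i) (s (Suc i) f) = \<delta> (Suc i) f - s i (D' i f)"
    using F'.null_homotopy[OF \<delta> aug chain] by blast
  let ?Z = "tor_cycles B d D i j" and ?W = "tor_boundaries B d D i j"
  let ?Z' = "tor_cycles B' d' D' i j" and ?W' = "tor_boundaries B' d' D' i j"
  have Z'_comp: "v \<in> tensor_component (B' i) (d' i) j" if "v \<in> ?Z'" for v
    using that by (simp add: tor_cycles_eq)
  note Z'_keys = tensor_component_keys[OF Z'_comp]
  have homotopic: "reduction (\<psi> i) (reduction (\<phi> i) v) - v \<in> ?W'" if v: "v \<in> ?Z'" for v
  proof -
    let ?v = "constant_vector v :: nat \<Rightarrow>\<^sub>0 ('s, 'k) mpoly"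
    have v_in: "?v \<in> free_mod U' (B' i)" by (intro constant_vector_in_free_mod Z'_keys[OF v])
    have "reduction (\<psi> i) (reduction (\<phi> i) v) - v = constant_part (\<delta> i ?v)"
      using reduction_comp[OF \<rho> \<psi>(1) \<phi>(1) Z'_keys[OF v]]
      by (simp add: \<delta>_def constant_part_diff constant_vector_part)
    also have "constant_part (\<delta> i ?v) = constant_part (D' i (s i ?v))"
    proof (cases i)
      case 0
      then show ?thesis using s(2) v_in by simp
    next
      case (Suc k)
      have "constant_part (s k (D' k ?v)) = reduction (s k) (reduction (D' k) v)"
        using reduction_comp[OF graded_hom_id s(1) F'.D_graded, of v k] Z'_keys[OF v] Suc by simp
      also have "\<dots> = 0"
        using v Suc reduction_zero[OF s(1)] by (simp add: tor_cycles_eq)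
      finally show ?thesis using s(3)[of ?v k] v_in Suc by (simp add: constant_part_diff)
    qed
    also have "\<dots> = reduction (D' i) (reduction (s i) v)"
      using reduction_comp[OF graded_hom_id F'.D_graded s(1) Z'_keys[OF v]] by simp
    also have "\<dots> \<in> ?W'"
      unfolding tor_boundaries_eq by (intro imageI reduction_component[OF s(1)] Z'_comp v)
    finally show ?thesis .
  qed
  have "kdim ?Z' - kdim ?W' \<le> kdim ?Z - kdim ?W"
    unfolding kdim_def
  proof (rule coefficients.quotient_dim_le[where f = "reduction (\<phi> i)",
        OF F.tor_cycles_subspace F.tor_boundaries_subspace F'.tor_cycles_subspace
          F'.tor_boundaries_subspace F.tor_boundaries_subset F'.tor_boundaries_subset
          F.tor_cycles_span F'.tor_cycles_span])
    fix v assume v: "v \<in> ?Z'"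
    have "reduction (D k) (reduction (\<phi> i) v) = 0" if k: "i = Suc k" for k
    proof -
      have "reduction (D k) (reduction (\<phi> (Suc k)) v) = constant_part (D k (\<phi> (Suc k) (constant_vector v)))"
        using reduction_comp[OF graded_hom_id F.D_graded \<phi>(1), of v k] Z'_keys[OF v] k by simp
      also have "\<dots> = constant_part (\<phi> k (D' k (constant_vector v)))"
        using \<phi>(3)[OF constant_vector_in_free_mod, of v k] Z'_keys[OF v] k by simp
      also have "\<dots> = reduction (\<phi> k) (reduction (D' k) v)"
        using reduction_comp[OF \<eta> \<phi>(1) F'.D_graded, of v k] Z'_keys[OF v] k by simp
      also have "\<dots> = 0"
        using v k reduction_zero[OF \<phi>(1)] by (simp add: tor_cycles_eq)
      finally show ?thesis using k by simp
    qed
    then show "reduction (\<phi> i) v \<in> ?Z"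
      using reduction_component[OF \<phi>(1) Z'_comp[OF v]] by (auto simp: tor_cycles_eq split: nat.split)
    show "reduction (\<phi> i) (smul c v) = smul c (reduction (\<phi> i) v)" for c
      by (intro reduction_smul[OF \<eta> \<phi>(1)] Z'_keys v)
    show "reduction (\<phi> i) (v + w) = reduction (\<phi> i) v + reduction (\<phi> i) w" if "w \<in> ?Z'" for w
      by (intro reduction_add[OF \<phi>(1)] Z'_keys v that)
    assume "reduction (\<phi> i) v \<in> ?W"
    then obtain w where w: "w \<in> tensor_component (B (Suc i)) (d (Suc i)) j"
        "reduction (\<phi> i) v = reduction (D i) w"
      by (auto simp: tor_boundaries_eq)
    note w_keys = tensor_component_keys[OF w(1)]
    have "reduction (\<psi> i) (reduction (\<phi> i) v) = constant_part (\<psi> i (D i (constant_vector w)))"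
      using reduction_comp[OF \<rho> \<psi>(1) F.D_graded w_keys] w(2) by simp
    also have "\<dots> = constant_part (D' i (\<psi> (Suc i) (constant_vector w)))"
      using \<psi>(3)[OF constant_vector_in_free_mod[OF w_keys]] by simp
    also have "\<dots> = reduction (D' i) (reduction (\<psi> (Suc i)) w)"
      using reduction_comp[OF graded_hom_id F'.D_graded \<psi>(1) w_keys] by simp
    also have "\<dots> \<in> ?W'"
      unfolding tor_boundaries_eq by (intro imageI reduction_component[OF \<psi>(1)] w(1))
    finally have "reduction (\<psi> i) (reduction (\<phi> i) v) \<in> ?W'" .
    from coefficients.subspace_diff[OF F'.tor_boundaries_subspace this homotopic[OF v]]
    show "v \<in> ?W'" by simp
  qed
  then show ?thesis by (simp add: tor_dim_def)
qed

section \<open>Existence of graded free resolutions\<close>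

interpretation scalars: vector_space
  "\<lambda>c. smul (mconst c) :: ('b \<Rightarrow>\<^sub>0 ('v, 'k::field) mpoly) \<Rightarrow> ('b \<Rightarrow>\<^sub>0 ('v, 'k) mpoly)"
  by standard (simp_all add: smul_add_right smul_add_left smul_smul mconst_add mconst_mult)

lemma finite_monomials:
  assumes "finite V"
  shows "finite {m :: 'v \<Rightarrow>\<^sub>0 nat. keys m \<subseteq> V \<and> mdeg m = k}"
proof (induction k)
  case 0
  have "{m :: 'v \<Rightarrow>\<^sub>0 nat. keys m \<subseteq> V \<and> mdeg m = 0} \<subseteq> {0}" by (auto simp: mdeg_eq_0_iff)
  then show ?case by (rule finite_subset) simp
next
  case (Suc k)
  let ?M = "\<lambda>k. {m :: 'v \<Rightarrow>\<^sub>0 nat. keys m \<subseteq> V \<and> mdeg m = k}"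
  have "m \<in> (\<lambda>(v, m). single v 1 + m) ` (V \<times> ?M k)" if "m \<in> ?M (Suc k)" for m
  proof -
    have "keys m \<subseteq> V" "mdeg m = Suc k" using that by auto
    then show ?thesis
    proof (induction m rule: monomial_induct)
      case (var v m)
      then have "m \<in> ?M k" by (simp add: mdeg_add)
      with var(1) show ?case by (intro image_eqI[of _ _ "(v, m)"]) auto
    qed simp
  qed
  then have "?M (Suc k) \<subseteq> (\<lambda>(v, m). single v 1 + m) ` (V \<times> ?M k)" by blast
  moreover have "finite ((\<lambda>(v, m). single v 1 + m) ` (V \<times> ?M k))"
    using Suc assms by (intro finite_imageI finite_cartesian_product)
  ultimately show ?case by (rule finite_subset)
qed

definition graded_submodule ::
    "'v set \<Rightarrow> 'b set \<Rightarrow> ('b \<Rightarrow> int) \<Rightarrow> ('b \<Rightarrow>\<^sub>0 ('v, 'k::field) mpoly) set \<Rightarrow> bool" where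
  "graded_submodule U B d Z \<longleftrightarrow> Z \<subseteq> free_mod U B \<and> 0 \<in> Z \<and> (\<forall>f\<in>Z. \<forall>g\<in>Z. f + g \<in> Z) \<and>
     (\<forall>p\<in>mpolys U. \<forall>f\<in>Z. smul p f \<in> Z) \<and> (\<forall>j. \<forall>f\<in>Z. free_part d j f \<in> Z)"

text \<open>
  Nonnegative degrees and finitely many basis elements in each degree make the graded pieces of
  the free module finite-dimensional over \<open>K\<close>.
\<close>
definition degrees_finite :: "'b set \<Rightarrow> ('b \<Rightarrow> int) \<Rightarrow> bool" where
  "degrees_finite B d \<longleftrightarrow> (\<forall>b\<in>B. 0 \<le> d b) \<and> (\<forall>j. finite {b \<in> B. d b = j})"

lemma kernel_graded_submodule:
  assumes "graded_map (\<lambda>p. p) U B d U' B' d' \<phi>"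
  shows "graded_submodule U B d {f \<in> free_mod U B. \<phi> f = 0}"
  unfolding graded_submodule_def
  by (simp add: subset_iff add_in_free_mod smul_in_free_mod free_part_in_free_mod graded_map_zero[OF assms]
      graded_map_add[OF assms] graded_map_smul[OF assms] graded_map_free_part[OF assms])

lemma free_component_spanned:
  fixes U :: "'v set" and B :: "'b set"
  assumes U: "finite U" and B: "degrees_finite B d"
  obtains T :: "('b \<Rightarrow>\<^sub>0 ('v, 'k::field) mpoly) set"
    where "finite T" "free_component U B d j \<subseteq> scalars.span T"
proof -
  define M where "M b = {m :: 'v \<Rightarrow>\<^sub>0 nat. keys m \<subseteq> U \<and> int (mdeg m) = j - d b}" for b
  define T :: "('b \<Rightarrow>\<^sub>0 ('v, 'k) mpoly) set"
    where "T = (\<lambda>(b, m). single b (single m 1)) ` (SIGMA b:{b \<in> B. d b \<le> j}. M b)"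
  have "finite (M b)" for b
    using finite_monomials[OF U, of "nat (j - d b)"]
    by (rule finite_subset[rotated]) (auto simp: M_def)
  moreover have "{b \<in> B. d b \<le> j} \<subseteq> (\<Union>i\<in>{0..j}. {b \<in> B. d b = i})"
    using B by (auto simp: degrees_finite_def)
  then have "finite {b \<in> B. d b \<le> j}"
    by (rule finite_subset) (use B in \<open>simp add: degrees_finite_def\<close>)
  ultimately have "finite T" unfolding T_def by (intro finite_imageI finite_SigmaI)
  moreover have "free_component U B d j \<subseteq> scalars.span T"
  proof
    fix f :: "'b \<Rightarrow>\<^sub>0 ('v, 'k) mpoly" assume f: "f \<in> free_component U B d j"
    have monomial: "single b (single m c) \<in> scalars.span T" if "b \<in> B" "m \<in> M b" for b m and c :: 'k
    proof -
      have "d b \<le> j" using that(2) by (simp add: M_def)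
      then have "single b (single m 1) \<in> T"
        using that unfolding T_def by (intro image_eqI[of _ _ "(b, m)"]) auto
      then have "smul (mconst c) (single b (single m 1)) \<in> scalars.span T"
        by (intro scalars.span_scale scalars.span_base)
      then show ?thesis by (simp add: smul_single single_conv_mconst[of m c])
    qed
    show "f \<in> scalars.span T"
    proof (rule poly_mapping_keys_induct[where R = "\<lambda>b p. b \<in> B \<and> p \<in> hom_mpolys U (j - d b)"])
      show "b \<in> B \<and> lookup f b \<in> hom_mpolys U (j - d b)" if "b \<in> keys f" for b
        using f that by (auto simp: free_component_def free_mod_def)
    next
      fix b and p :: "('v, 'k) mpoly" assume bp: "b \<in> B \<and> p \<in> hom_mpolys U (j - d b)"
      show "single b p \<in> scalars.span T"
      proof (rule poly_mapping_keys_induct[where R = "\<lambda>m c. m \<in> M b" and P = "\<lambda>p. single b p \<in> scalars.span T"])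
        show "m \<in> M b" if "m \<in> keys p" for m
          using bp that by (auto simp: hom_mpolys_def mpolys_def M_def)
      qed (use bp monomial in \<open>simp_all add: scalars.span_zero single_add scalars.span_add\<close>)
    qed (rule scalars.span_zero, rule scalars.span_add)
  qed
  ultimately show thesis by (rule that)
qed

lemma sum_free_part:
  assumes "f \<in> free_mod V B"
  shows "\<exists>J. finite J \<and> (\<forall>J'. finite J' \<longrightarrow> J \<subseteq> J' \<longrightarrow> f = (\<Sum>j\<in>J'. free_part d j f))"
  using assms
proof (induction f rule: free_mod_induct)
  case zero
  show ?case by (intro exI[of _ "{}"]) simp
next
  case (single b m c)
  then have "single b (single m c) \<in> free_component V B d (int (mdeg m) + d b)"
    by (simp add: single_in_free_component single_in_hom_mpolys)
  from free_part_component[OF this] show ?case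
    by (intro exI[of _ "{int (mdeg m) + d b}"]) simp
next
  case (add f g)
  then obtain J K where "finite J" "\<forall>J'. finite J' \<longrightarrow> J \<subseteq> J' \<longrightarrow> f = (\<Sum>j\<in>J'. free_part d j f)"
    "finite K" "\<forall>J'. finite J' \<longrightarrow> K \<subseteq> J' \<longrightarrow> g = (\<Sum>j\<in>J'. free_part d j g)" by blast
  then show ?case
    by (intro exI[of _ "J \<union> K"]) (simp add: free_part_add sum.distrib)
qed

lemma hom_mpolys_negative: "j < 0 \<Longrightarrow> hom_mpolys V j = {0}"
  by (auto simp: hom_mpolys_def mpolys_def simp flip: keys_eq_empty)

text \<open>
  For every \<open>n\<close> take a finite \<open>K\<close>-basis \<open>xs n\<close> of the degree \<open>n\<close> piece of \<open>Z\<close> and one new basis element of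
  degree \<open>n\<close> for each of its members.  The image of the resulting map contains all homogeneous
  elements of \<open>Z\<close>, hence \<open>Z\<close>, which is graded.
\<close>
lemma graded_cover:
  fixes Z :: "('b \<Rightarrow>\<^sub>0 ('v, 'k::field) mpoly) set"
  assumes U: "finite U" and B: "degrees_finite B d" and Z: "graded_submodule U B d Z"
  shows "\<exists>(B' :: nat set) d' \<phi>. degrees_finite B' d' \<and> graded_map (\<lambda>p. p) U B' d' U B d \<phi> \<and>
    \<phi> ` free_mod U B' = Z"
proof -
  have Z_sub: "Z \<subseteq> free_mod U B" and Z0: "0 \<in> Z"
    and Z_add: "\<And>f g. f \<in> Z \<Longrightarrow> g \<in> Z \<Longrightarrow> f + g \<in> Z"
    and Z_smul: "\<And>p f. p \<in> mpolys U \<Longrightarrow> f \<in> Z \<Longrightarrow> smul p f \<in> Z"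
    and Z_free_part: "\<And>j f. f \<in> Z \<Longrightarrow> free_part d j f \<in> Z"
    using Z by (auto simp: graded_submodule_def)
  have "\<exists>xs. set xs \<subseteq> Z \<inter> free_component U B d (int n) \<and>
      Z \<inter> free_component U B d (int n) \<subseteq> scalars.span (set xs)" for n
  proof -
    obtain T :: "('b \<Rightarrow>\<^sub>0 ('v, 'k) mpoly) set"
      where T: "finite T" "free_component U B d (int n) \<subseteq> scalars.span T"
      using free_component_spanned[OF U B] by blast
    obtain G where G: "G \<subseteq> Z \<inter> free_component U B d (int n)" "\<not> scalars.dependent G"
        "Z \<inter> free_component U B d (int n) \<subseteq> scalars.span G"
      using scalars.maximal_independent_subset by blast
    have "G \<subseteq> scalars.span T" using G(1) T(2) by blast
    then have "finite G" using scalars.independent_span_bound[OF T(1) G(2)] by blast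
    then obtain xs where "set xs = G" using finite_list by blast
    with G show ?thesis by blast
  qed
  then obtain xs where xs: "\<And>n. set (xs n) \<subseteq> Z \<inter> free_component U B d (int n)"
      "\<And>n. Z \<inter> free_component U B d (int n) \<subseteq> scalars.span (set (xs n))"
    by metis
  \<comment> \<open>the number coding \<open>(n, k)\<close> is the basis element of degree \<open>n\<close> mapping to the \<open>k\<close>-th member of \<open>xs n\<close>\<close>
  define d' where "d' b = int (fst (prod_decode b))" for b
  define y where "y b = xs (fst (prod_decode b)) ! snd (prod_decode b)" for b
  define B' where "B' = {b. snd (prod_decode b) < length (xs (fst (prod_decode b)))}"
  have y_in: "y b \<in> set (xs (fst (prod_decode b)))" if "b \<in> B'" for b
    using that by (simp add: y_def B'_def)
  have "{b \<in> B'. d' b = j} \<subseteq> prod_encode ` ({nat j} \<times> {..<length (xs (nat j))})" for j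
  proof
    fix b assume "b \<in> {b \<in> B'. d' b = j}"
    then have "prod_decode b \<in> {nat j} \<times> {..<length (xs (nat j))}"
      by (auto simp: B'_def d'_def mem_Times_iff)
    then show "b \<in> prod_encode ` ({nat j} \<times> {..<length (xs (nat j))})"
      by (metis imageI prod_decode_inverse)
  qed
  then have "finite {b \<in> B'. d' b = j}" for j by (rule finite_subset) simp
  then have B': "degrees_finite B' d'" by (simp add: degrees_finite_def) (simp add: d'_def)
  have "y b \<in> free_component U B d (d' b)" if "b \<in> B'" for b
    using y_in[OF that] xs(1) by (auto simp: d'_def)
  then have "\<exists>\<phi>. graded_map (\<lambda>p. p) U B' d' U B d \<phi> \<and> (\<forall>b\<in>B'. \<phi> (single b 1) = y b)"
    by (rule free_extension[OF graded_hom_id])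
  then obtain \<phi> where \<phi>: "graded_map (\<lambda>p. p) U B' d' U B d \<phi>" "\<forall>b\<in>B'. \<phi> (single b 1) = y b"
    by (elim exE conjE)
  have "\<phi> f \<in> Z" if "f \<in> free_mod U B'" for f
    using that
  proof (induction f rule: free_mod_induct)
    case zero
    then show ?case using Z0 graded_map_zero[OF \<phi>(1)] by simp
  next
    case (single b m c)
    have "y b \<in> Z" using y_in[OF single(1)] xs(1) by blast
    then show ?case
      using graded_map_smul[OF \<phi>(1) single_in_mpolys[OF single(2), of c] single_in_free_mod[OF single(1) one_in_mpolys]]
        bspec[OF \<phi>(2) single(1)] Z_smul[OF single_in_mpolys[OF single(2), of c], of "y b"]
      by (simp add: smul_single)
  next
    case (add f g)
    then show ?case using graded_map_add[OF \<phi>(1)] Z_add by simp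
  qed
  moreover have "z \<in> \<phi> ` free_mod U B'" if z: "z \<in> Z" for z
  proof -
    have image_0: "0 \<in> \<phi> ` free_mod U B'"
      using graded_map_zero[OF \<phi>(1)] by (metis image_eqI zero_in_free_mod)
    have image_add: "v + w \<in> \<phi> ` free_mod U B'" if vw: "v \<in> \<phi> ` free_mod U B'" "w \<in> \<phi> ` free_mod U B'" for v w
    proof -
      obtain f g where "f \<in> free_mod U B'" "g \<in> free_mod U B'" "v = \<phi> f" "w = \<phi> g" using vw by blast
      then show ?thesis
        using graded_map_add[OF \<phi>(1), of f g] add_in_free_mod[of f U B' g] by (metis imageI)
    qed
    have subspace: "scalars.subspace (\<phi> ` free_mod U B')"
    proof (rule scalars.subspaceI)
      fix c v assume "v \<in> \<phi> ` free_mod U B'"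
      then obtain f where "f \<in> free_mod U B'" "v = \<phi> f" by blast
      then show "smul (mconst c) v \<in> \<phi> ` free_mod U B'"
        using graded_map_smul[OF \<phi>(1), of "mconst c" f] smul_in_free_mod[of "mconst c" U f B'] by (metis imageI mconst_in_mpolys)
    qed (fact image_0, fact image_add)
    have "set (xs n) \<subseteq> \<phi> ` free_mod U B'" for n
    proof
      fix x assume "x \<in> set (xs n)"
      then obtain k where "k < length (xs n)" "x = xs n ! k" by (metis in_set_conv_nth)
      then have "prod_encode (n, k) \<in> B'" "y (prod_encode (n, k)) = x" by (simp_all add: B'_def y_def)
      then show "x \<in> \<phi> ` free_mod U B'"
        using \<phi>(2) single_in_free_mod[of "prod_encode (n, k)" B' 1 U] by (metis imageI one_in_mpolys)
    qed
    then have "scalars.span (set (xs n)) \<subseteq> \<phi> ` free_mod U B'" for n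
      by (intro scalars.span_minimal subspace)
    then have homogeneous: "free_part d (int n) z \<in> \<phi> ` free_mod U B'" for n
      using xs(2)[of n] Z_free_part[OF z] free_part_in_free_component[of z U B d] z Z_sub by blast
    have parts: "free_part d j z \<in> \<phi> ` free_mod U B'" for j
    proof (cases "j \<ge> 0")
      case True
      then show ?thesis using homogeneous[of "nat j"] by simp
    next
      case False
      have comp: "free_part d j z \<in> free_component U B d j"
        using free_part_in_free_component[of z U B d] z Z_sub by blast
      have "lookup (free_part d j z) b = 0" for b
      proof (cases "b \<in> B")
        case True
        then have "j - d b < 0" using False B by (auto simp: degrees_finite_def)
        then show ?thesis
          using comp hom_mpolys_negative[of "j - d b" U] by (auto simp: free_component_def)
      next
        case False
        then show ?thesis using comp by (auto simp: free_component_def free_mod_def in_keys_iff)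
      qed
      then have "free_part d j z = 0" by (intro poly_mapping_eqI) simp
      then show ?thesis using image_0 by simp
    qed
    obtain J where "z = (\<Sum>j\<in>J. free_part d j z)"
      using sum_free_part[of z U B d] z Z_sub by blast
    moreover have "(\<Sum>j\<in>J. free_part d j z) \<in> \<phi> ` free_mod U B'"
      by (induction J rule: infinite_finite_induct) (simp_all add: image_0 image_add parts)
    ultimately show ?thesis by simp
  qed
  ultimately have "\<phi> ` free_mod U B' = Z" by blast
  with B' \<phi>(1) show ?thesis by blast
qed

context toric_algebra
begin

lemma augmentation_kernel:
  "graded_submodule U {0::nat} (\<lambda>_. 0) {f \<in> free_mod U {0}. toric_map \<iota> (lookup f 0) = 0}"
proof -
  have "lookup f 0 \<in> mpolys U" if "f \<in> free_mod U {0::nat}" for f :: "nat \<Rightarrow>\<^sub>0 ('r, 'k) mpoly"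
    using that by (simp add: free_mod_def)
  then show ?thesis
    unfolding graded_submodule_def
    by (simp add: subset_iff add_in_free_mod smul_in_free_mod free_part_in_free_mod lookup_add lookup_smul toric_map_add
        toric_map_mult lookup_free_part kernel_homogeneous)
qed

text \<open>
  Start with \<open>F\<^sub>0 = P\<close> and the toric map, and cover the kernel of each map by the next free module.  A
  state of the recursion is a free module, given by basis and degrees, together with the graded
  submodule that is to be covered.
\<close>
theorem resolution_exists:
  assumes U: "finite U"
  shows "\<exists>B d D e. graded_free_resolution \<iota> U A B d D e"
proof -
  define e where "e f = toric_map \<iota> (lookup f (0::nat))" for f
  define P where "P n x \<longleftrightarrow> (case x of (B, d, Z) \<Rightarrow> degrees_finite B d \<and> graded_submodule U B d Z) \<and>
      (n = 0 \<longrightarrow> x = ({0}, \<lambda>_. 0, {f \<in> free_mod U {0}. e f = 0}))"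
    for n :: nat and x :: "nat set \<times> (nat \<Rightarrow> int) \<times> (nat \<Rightarrow>\<^sub>0 ('r, 'k) mpoly) set"
  define Q where "Q x x' \<longleftrightarrow> (case x of (B, d, Z) \<Rightarrow> case x' of (B', d', Z') \<Rightarrow>
      \<exists>D. graded_map (\<lambda>p. p) U B' d' U B d D \<and> D ` free_mod U B' = Z \<and> Z' = {f \<in> free_mod U B'. D f = 0})"
    for x x' :: "nat set \<times> (nat \<Rightarrow> int) \<times> (nat \<Rightarrow>\<^sub>0 ('r, 'k) mpoly) set"
  have "\<exists>X. \<forall>n. P n (X n) \<and> Q (X n) (X (Suc n))"
  proof (rule dependent_nat_choice)
    have "degrees_finite {0::nat} (\<lambda>_. 0)" by (simp add: degrees_finite_def)
    then show "\<exists>x. P 0 x" using augmentation_kernel by (auto simp: P_def e_def)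
  next
    fix x n assume "P n x"
    then obtain B d Z where x: "x = (B, d, Z)" "degrees_finite B d" "graded_submodule U B d Z"
      by (cases x) (auto simp: P_def)
    from graded_cover[OF U x(2,3)] obtain B' :: "nat set" and d' D
      where D: "degrees_finite B' d'" "graded_map (\<lambda>p. p) U B' d' U B d D" "D ` free_mod U B' = Z"
      by blast
    then show "\<exists>x'. P (Suc n) x' \<and> Q x x'"
      using kernel_graded_submodule[OF D(2)] x(1)
      by (intro exI[of _ "(B', d', {f \<in> free_mod U B'. D f = 0})"]) (auto simp: P_def Q_def)
  qed
  then obtain X where X: "\<And>n. P n (X n)" "\<And>n. Q (X n) (X (Suc n))" by blast
  define B where "B n = fst (X n)" for n
  define d where "d n = fst (snd (X n))" for n
  define Z where "Z n = snd (snd (X n))" for n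
  have X_eq: "X n = (B n, d n, Z n)" for n by (simp add: B_def d_def Z_def)
  have zero: "B 0 = {0}" "d 0 = (\<lambda>_. 0)" "Z 0 = {f \<in> free_mod U {0}. e f = 0}"
    using X(1)[of 0] by (simp_all add: P_def X_eq)
  have "\<forall>n. \<exists>D. graded_map (\<lambda>p. p) U (B (Suc n)) (d (Suc n)) U (B n) (d n) D \<and>
      D ` free_mod U (B (Suc n)) = Z n \<and> Z (Suc n) = {f \<in> free_mod U (B (Suc n)). D f = 0}"
    using X(2) by (simp add: Q_def X_eq)
  from choice[OF this] obtain D
    where D: "\<And>n. graded_map (\<lambda>p. p) U (B (Suc n)) (d (Suc n)) U (B n) (d n) (D n)"
      "\<And>n. D n ` free_mod U (B (Suc n)) = Z n" "\<And>n. Z (Suc n) = {f \<in> free_mod U (B (Suc n)). D n f = 0}"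
    by blast
  have fin: "finite {b \<in> B n. d n b = j}" for n j
    using X(1)[of n] by (simp add: P_def X_eq degrees_finite_def)
  have e_image: "e ` free_mod U (B 0) = A"
  proof -
    have "e f \<in> A" if "f \<in> free_mod U (B 0)" for f
      using that by (auto simp: e_def algebra_eq free_mod_def)
    moreover have "a \<in> e ` free_mod U (B 0)" if a: "a \<in> A" for a
    proof -
      obtain p where p: "p \<in> mpolys U" "a = toric_map \<iota> p" using a algebra_eq by blast
      then have "single 0 p \<in> free_mod U (B 0)" "a = e (single 0 p)"
        by (simp_all add: zero single_in_free_mod e_def)
      then show ?thesis by blast
    qed
    ultimately show ?thesis by blast
  qed
  have "e f \<in> alg_component \<iota> U j" if "f \<in> free_component U (B 0) (d 0) j" for f j
  proof -
    have "lookup f 0 \<in> hom_mpolys U j" using that zero by (auto simp: free_component_def)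
    then show ?thesis by (auto simp: e_def alg_component_def)
  qed
  then have e_comp: "e ` free_component U (B 0) (d 0) j \<subseteq> alg_component \<iota> U j" for j by blast
  have "graded_free_resolution \<iota> U A B d D e"
    unfolding graded_free_resolution_def
  proof (intro conjI allI ballI)
    show "D i ` free_component U (B (Suc i)) (d (Suc i)) j \<subseteq> free_component U (B i) (d i) j" for i j
      using graded_map_component[OF D(1)] by blast
    show "{f \<in> free_mod U (B 0). e f = 0} = D 0 ` free_mod U (B 1)"
      using D(2)[of 0] zero by simp
    show "{f \<in> free_mod U (B (Suc i)). D i f = 0} = D (Suc i) ` free_mod U (B (Suc (Suc i)))" for i
      using D(2)[of "Suc i"] D(3)[of i] by simp
  qed (use fin e_comp e_image graded_map_add[OF D(1)] graded_map_smul[OF D(1)] in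
      \<open>simp_all add: e_def lookup_add lookup_smul toric_map_add toric_map_mult\<close>)
  then show ?thesis by blast
qed

lemma betti_witness:
  assumes "finite U"
  obtains B d D e where "resolution \<iota> U A B d D e" "betti \<iota> U A i j = tor_dim B d D i j"
proof -
  have "\<exists>\<beta> B d D e. graded_free_resolution \<iota> U A B d D e \<and> \<beta> = tor_dim B d D i j"
    using resolution_exists[OF assms] by blast
  from someI_ex[OF this] obtain B d D e
    where "graded_free_resolution \<iota> U A B d D e" "betti \<iota> U A i j = tor_dim B d D i j"
    unfolding betti_def by blast
  then show thesis
    using that toric_algebra_axioms by (auto simp: resolution_def resolution_axioms_def)
qed

end

text \<open>
  Each Betti number is the dimension computed from some resolution, and \<open>tor_dim_retract\<close> compares any
  two resolutions.
\<close>
theorem betti_retract: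
  fixes \<iota> :: "'k::field \<Rightarrow> 'r::comm_ring_1" and \<iota>' :: "'k \<Rightarrow> 's::comm_ring_1"
  assumes "toric_algebra \<iota> U A" "finite U" "toric_algebra \<iota>' U' A'" "finite U'"
    and "graded_hom U' U \<eta>" "graded_hom U U' \<rho>" "\<And>p. p \<in> mpolys U' \<Longrightarrow> \<rho> (\<eta> p) = p"
    and "\<And>p. p \<in> mpolys U' \<Longrightarrow> toric_map \<iota>' p = 0 \<Longrightarrow> toric_map \<iota> (\<eta> p) = 0"
    and "\<And>p. p \<in> mpolys U \<Longrightarrow> toric_map \<iota> p = 0 \<Longrightarrow> toric_map \<iota>' (\<rho> p) = 0"
  shows "betti \<iota>' U' A' i j \<le> betti \<iota> U A i j"
proof -
  obtain B d D e where F: "resolution \<iota> U A B d D e" "betti \<iota> U A i j = tor_dim B d D i j"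
    using toric_algebra.betti_witness[OF assms(1,2)] by blast
  obtain B' d' D' e' where F': "resolution \<iota>' U' A' B' d' D' e'" "betti \<iota>' U' A' i j = tor_dim B' d' D' i j"
    using toric_algebra.betti_witness[OF assms(3,4)] by blast
  show ?thesis
    unfolding F(2) F'(2)
    by (rule tor_dim_retract[where \<eta> = \<eta> and \<rho> = \<rho>, OF F(1) F'(1) assms(5,6)]) (fact assms(7-9))+
qed

section \<open>Toric presentations of edge rings and Rees algebras\<close>

lemma mpolys_closure:
  assumes "p \<in> mpolys V"
    and const: "\<And>c. mconst c \<in> T" and var: "\<And>v. v \<in> V \<Longrightarrow> mvar v \<in> T"
    and add: "\<And>p q. p \<in> T \<Longrightarrow> q \<in> T \<Longrightarrow> p + q \<in> T"
    and mult: "\<And>p q. p \<in> T \<Longrightarrow> q \<in> T \<Longrightarrow> p * q \<in> T"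
  shows "p \<in> T"
  using assms(1)
proof (induction p rule: mpolys_induct)
  case zero
  then show ?case using const[of 0] by simp
next
  case (single m c)
  then have "single m 1 \<in> T"
  proof (induction m rule: monomial_induct)
    case zero
    then show ?case using const[of 1] by (simp add: mconst_def)
  next
    case (var v m)
    then show ?case using mult[OF assms(3)[OF var(1)] var(3)] by (simp add: single_mvar_add[simplified])
  qed
  then show ?case using mult[OF const[of c]] by (simp add: single_conv_mconst[of m c])
qed (rule add)

lemma (in scalar_hom) toric_image_subalgebra: "subalgebra \<iota> (toric_map \<iota> ` mpolys U)"
proof -
  have "\<iota> c \<in> toric_map \<iota> ` mpolys U" for c
    by (rule image_eqI[of _ _ "mconst c"]) (simp_all add: toric_map_eq_eval_at)
  moreover have "a + b \<in> toric_map \<iota> ` mpolys U \<and> a * b \<in> toric_map \<iota> ` mpolys U"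
    if ab: "a \<in> toric_map \<iota> ` mpolys U" "b \<in> toric_map \<iota> ` mpolys U" for a b
  proof -
    obtain p q where "p \<in> mpolys U" "q \<in> mpolys U" "a = toric_map \<iota> p" "b = toric_map \<iota> q"
      using ab by blast
    then show ?thesis
      using add_in_mpolys[of p U q] mult_in_mpolys[of p U q]
      by (simp add: toric_map_eq_eval_at eval_at_add[symmetric] eval_at_mult[symmetric])
  qed
  ultimately show ?thesis unfolding subalgebra_def by blast
qed

lemma (in scalar_hom) subalgebra_hull_eq: "subalgebra \<iota> hull U = toric_map \<iota> ` mpolys U"
proof (rule hull_unique)
  show "U \<subseteq> toric_map \<iota> ` mpolys U"
    by (auto simp: toric_map_eq_eval_at mvar_in_mpolys intro!: image_eqI[of _ _ "mvar _"])
  show "subalgebra \<iota> (toric_map \<iota> ` mpolys U)" by (rule toric_image_subalgebra)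
next
  fix T assume T: "U \<subseteq> T" "subalgebra \<iota> T"
  show "toric_map \<iota> ` mpolys U \<subseteq> T"
  proof (rule image_subsetI)
    fix p :: "('r, 'k) mpoly" assume "p \<in> mpolys U"
    then have "p \<in> {p. toric_map \<iota> p \<in> T}"
      by (rule mpolys_closure)
        (use T in \<open>auto simp: subalgebra_def toric_map_eq_eval_at eval_at_add eval_at_mult\<close>)
    then show "toric_map \<iota> p \<in> T" by simp
  qed
qed

lemma (in scalar_hom) eval_at_eval_monom:
  "eval_at \<iota> \<tau> (eval_monom \<sigma> m) = eval_monom (\<lambda>v. eval_at \<iota> \<tau> (\<sigma> v)) m"
  by (induction m rule: monomial_induct[where V = UNIV, OF subset_UNIV])
    (simp_all add: eval_monom_add eval_at_mult)

lemma (in scalar_hom) eval_at_comp: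
  "eval_at \<iota> \<tau> (eval_at mconst \<sigma> p) = eval_at \<iota> (\<lambda>v. eval_at \<iota> \<tau> (\<sigma> v)) p"
  by (induction p rule: poly_mapping_add_induct)
    (simp_all add: mconst.eval_at_single eval_at_single mconst.eval_at_add eval_at_add eval_at_mult
      eval_at_eval_monom)

lemma eval_at_cong:
  assumes "p \<in> mpolys V" "\<And>v. v \<in> V \<Longrightarrow> \<sigma> v = \<tau> v"
  shows "eval_at \<iota> \<sigma> p = eval_at \<iota> \<tau> p"
proof -
  have "eval_monom \<sigma> m = eval_monom \<tau> m" if "m \<in> keys p" for m
  proof -
    have "keys m \<subseteq> V" using that assms(1) by (simp add: mpolys_def)
    then show ?thesis unfolding eval_monom_def by (intro prod.cong refl) (use assms(2) in force)
  qed
  then show ?thesis unfolding eval_at_def by (intro sum.cong) simp_all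
qed

lemma eval_monom_mvar: "eval_monom mvar m = single m 1"
  by (induction m rule: monomial_induct[where V = UNIV, OF subset_UNIV])
    (simp_all add: eval_monom_add single_mvar_add[simplified])

lemma eval_at_mvar_id: "eval_at mconst mvar p = p"
  by (induction p rule: poly_mapping_add_induct)
    (simp_all add: mconst.eval_at_single mconst.eval_at_add eval_monom_mvar single_conv_mconst[symmetric])

lemma edge_monomial:
  assumes "u \<in> edge_monomials E"
  obtains c where "u = single c 1" "mdeg c = 2"
proof -
  obtain i j where "u = mvar i * mvar j" using assms by (auto simp: edge_monomials_def)
  then have "u = single (single i 1 + single j 1) 1" by (simp add: mvar_def mult_single)
  then show thesis by (rule that) (simp add: mdeg_add)
qed

lemma edge_vertices:
  assumes "simple_graph n E" "{i, j} \<in> E"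
  shows "i \<in> {1..n}" "j \<in> {1..n}"
  using assms by (auto simp: simple_graph_def)

lemma finite_edge_monomials:
  assumes "simple_graph n E"
  shows "finite (edge_monomials E)"
proof (rule finite_subset)
  show "edge_monomials E \<subseteq> (\<lambda>(i, j). mvar i * mvar j) ` ({1..n} \<times> {1..n})"
    using edge_vertices[OF assms] by (fastforce simp: edge_monomials_def)
qed simp

interpretation rees_const: scalar_hom "rees_const :: 'k::field \<Rightarrow> (nat, 'k) mpoly poly"
  by standard (simp_all add: rees_const_def mconst_add mconst_mult one_pCons)

lemma rees_const_mult_monom: "rees_const k * monom (single c 1) s = monom (single c k) s"
  by (simp add: rees_const_def smult_monom single_conv_mconst[symmetric])

text \<open>
  A product of \<open>k\<close> edge monomials has degree \<open>2 k\<close>; marking each factor by \<open>T\<close> records this \<open>k\<close>.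
\<close>
lemma edge_ring_monomial:
  fixes m :: "(nat, 'k::field) mpoly \<Rightarrow>\<^sub>0 nat"
  assumes "keys m \<subseteq> edge_monomials E"
  shows "\<exists>c. eval_monom (\<lambda>u. u) m = single c 1 \<and>
    eval_monom (\<lambda>u. monom u 1) m = monom (single c 1) (mdeg m) \<and> mdeg c = 2 * mdeg m"
  using assms
proof (induction m rule: monomial_induct)
  case zero
  show ?case by (intro exI[of _ 0]) simp
next
  case (var u m)
  obtain c where c: "eval_monom (\<lambda>u. u) m = single c 1"
      "eval_monom (\<lambda>u. monom u 1) m = monom (single c 1) (mdeg m)" "mdeg c = 2 * mdeg m"
    using var by blast
  obtain c' :: "nat \<Rightarrow>\<^sub>0 nat" where c': "u = single c' 1" "mdeg c' = 2"
    using edge_monomial[OF var(1)] by blast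
  show ?case
    using c c' by (intro exI[of _ "c' + c"]) (simp add: eval_monom_add mult_single mult_monom mdeg_add)
qed

text \<open>
  Of the \<open>mdeg m\<close> generators in a product \<open>x\<^sup>c T\<^sup>s\<close>, exactly \<open>s\<close> are edge generators, of degree \<open>2\<close> in the
  \<open>x\<^sub>i\<close>, and the others are variables \<open>x\<^sub>i\<close>.  The substitution \<open>u \<mapsto> coeff u 1\<close> is the retraction on
  generators: \<open>x\<^sub>i\<close> has no coefficient at \<open>T\<close>, so it becomes \<open>0\<close>, and \<open>x\<^sub>i x\<^sub>j T\<close> becomes \<open>x\<^sub>i x\<^sub>j\<close>.  Thus a
  product survives precisely when it has no factor \<open>x\<^sub>i\<close>, that is, when \<open>|c| = 2 s\<close>.
\<close>
lemma rees_monomial: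
  fixes m :: "(nat, 'k::field) mpoly poly \<Rightarrow>\<^sub>0 nat"
  assumes "keys m \<subseteq> rees_generators n E"
  shows "\<exists>c s. eval_monom (\<lambda>u. u) m = monom (single c 1) s \<and> mdeg c = s + mdeg m \<and> 2 * s \<le> mdeg c \<and>
    eval_monom (\<lambda>u. coeff u 1) m = (if mdeg c = 2 * s then single c 1 else 0)"
  using assms
proof (induction m rule: monomial_induct)
  case zero
  show ?case by (intro exI[of _ 0]) simp
next
  case (var u m)
  obtain c s where c: "eval_monom (\<lambda>u. u) m = monom (single c 1) s" "mdeg c = s + mdeg m" "2 * s \<le> mdeg c"
      "eval_monom (\<lambda>u. coeff u 1) m = (if mdeg c = 2 * s then single c 1 else 0)"
    using var by blast
  consider i where "u = [:mvar i:]" | e where "e \<in> edge_monomials E" "u = monom e 1"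
    using var(1) by (auto simp: rees_generators_def)
  then show ?case
  proof cases
    case 1
    then have u: "u = monom (single (single i 1) 1) 0" by (simp add: monom_0 mvar_def)
    show ?thesis
      using c u by (intro exI[of _ "single i 1 + c"] exI[of _ s])
        (simp add: eval_monom_add mult_single mult_monom mdeg_add)
  next
    case 2
    then obtain c' where "e = single c' 1" "mdeg c' = 2" using edge_monomial by blast
    then show ?thesis
      using c 2(2) by (intro exI[of _ "c' + c"] exI[of _ "Suc s"])
        (auto simp: eval_monom_add mult_single mult_monom mdeg_add)
  qed
qed

text \<open>
  In this and the next three lemmas the image of \<open>p\<close> under a second map is read off coefficient by
  coefficient from its image under the toric map.  Hence the second map vanishes on the toric ideal.
\<close>
lemma lookup_toric_edge_hom_part:
  assumes "p \<in> mpolys (edge_monomials E)"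
  shows "lookup (toric_map mconst (hom_part j p)) c =
    (if int (mdeg c) = 2 * j then lookup (toric_map mconst p) c else 0)"
  using assms
proof (induction p rule: mpolys_induct)
  case (single m k)
  then obtain c0 where "eval_monom (\<lambda>u. u) m = single c0 1" "mdeg c0 = 2 * mdeg m"
    using edge_ring_monomial by blast
  then show ?case
    by (auto simp: toric_map_eq_eval_at hom_part_single mconst.eval_at_single lookup_single when_def
        single_conv_mconst[symmetric])
qed (simp_all add: toric_map_eq_eval_at mconst.eval_at_add hom_part_add lookup_add)

lemma coeff_toric_rees_hom_part:
  assumes "p \<in> mpolys (rees_generators n E)"
  shows "lookup (coeff (toric_map rees_const (hom_part j p)) s) c =
    (if int (mdeg c) = int s + j then lookup (coeff (toric_map rees_const p) s) c else 0)"
  using assms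
proof (induction p rule: mpolys_induct)
  case (single m k)
  then obtain c0 s0 where "eval_monom (\<lambda>u. u) m = monom (single c0 1) s0" "mdeg c0 = s0 + mdeg m"
    using rees_monomial by blast
  then show ?case
    by (auto simp: toric_map_eq_eval_at hom_part_single rees_const.eval_at_single lookup_single when_def
        rees_const_mult_monom single_conv_mconst[symmetric])
qed (simp_all add: toric_map_eq_eval_at rees_const.eval_at_add hom_part_add lookup_add)

lemma coeff_toric_edge_lift:
  assumes "p \<in> mpolys (edge_monomials E)"
  shows "lookup (coeff (eval_at rees_const (\<lambda>u. monom u 1) p) s) c =
    (if mdeg c = 2 * s then lookup (toric_map mconst p) c else 0)"
  using assms
proof (induction p rule: mpolys_induct)
  case (single m k)
  then obtain c0 where "eval_monom (\<lambda>u. u) m = single c0 1"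
      "eval_monom (\<lambda>u. monom u 1) m = monom (single c0 1) (mdeg m)" "mdeg c0 = 2 * mdeg m"
    using edge_ring_monomial by blast
  then show ?case
    by (auto simp: toric_map_eq_eval_at mconst.eval_at_single rees_const.eval_at_single lookup_single when_def
        rees_const_mult_monom single_conv_mconst[symmetric])
qed (simp_all add: toric_map_eq_eval_at rees_const.eval_at_add mconst.eval_at_add lookup_add)

lemma lookup_eval_rees_coeff:
  assumes "p \<in> mpolys (rees_generators n E)"
  shows "lookup (eval_at mconst (\<lambda>u. coeff u 1) p) c =
    (if even (mdeg c) then lookup (coeff (toric_map rees_const p) (mdeg c div 2)) c else 0)"
  using assms
proof (induction p rule: mpolys_induct)
  case (single m k)
  then obtain c0 s0 where "eval_monom (\<lambda>u. u) m = monom (single c0 1) s0"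
      "eval_monom (\<lambda>u. coeff u 1) m = (if mdeg c0 = 2 * s0 then single c0 1 else 0)"
    using rees_monomial by blast
  then show ?case
    by (auto simp: toric_map_eq_eval_at mconst.eval_at_single rees_const.eval_at_single lookup_single when_def
        rees_const_mult_monom single_conv_mconst[symmetric] split: if_splits)
qed (simp_all add: toric_map_eq_eval_at rees_const.eval_at_add mconst.eval_at_add lookup_add)

lemma edge_ring_toric:
  "toric_algebra (mconst :: 'k::field \<Rightarrow> (nat, 'k) mpoly) (edge_monomials E) (edge_ring E)"
proof
  show "edge_ring E = toric_map mconst ` mpolys (edge_monomials E)"
    unfolding edge_ring_def by (rule mconst.subalgebra_hull_eq)
next
  fix p :: "((nat, 'k) mpoly, 'k) mpoly" and j
  assume "p \<in> mpolys (edge_monomials E)" "toric_map mconst p = 0"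
  then show "toric_map mconst (hom_part j p) = 0"
    by (intro poly_mapping_eqI) (simp add: lookup_toric_edge_hom_part)
qed

text \<open>
  The hull of \<open>X\<close> is an ideal since \<open>mpolys V\<close> itself is one ideal containing \<open>X\<close>; an empty family of
  ideals would intersect in the whole type.
\<close>
lemma ideal_of_hull:
  assumes "X \<subseteq> mpolys V"
  shows "ideal_of (mpolys V) (ideal_of (mpolys V) hull X)"
proof -
  have "ideal_of (mpolys V :: ('a, 'b) mpoly set) (mpolys V)"
    by (simp add: ideal_of_def add_in_mpolys mult_in_mpolys)
  then have "ideal_of (mpolys V) hull X \<subseteq> mpolys V" using assms by (rule hull_minimal[rotated])
  then show ?thesis unfolding ideal_of_def hull_def by blast
qed

lemma ideal_power_ideal:
  assumes "ideal_of (mpolys V) I"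
  shows "ideal_of (mpolys V) (ideal_power (mpolys V) I s)"
proof (induction s)
  case 0
  show ?case by (simp add: ideal_of_def add_in_mpolys mult_in_mpolys)
next
  case (Suc s)
  have "{a * b |a b. a \<in> I \<and> b \<in> ideal_power (mpolys V) I s} \<subseteq> mpolys V"
    using assms Suc.IH by (auto simp: ideal_of_def intro!: mult_in_mpolys)
  then show ?case unfolding ideal_power.simps by (rule ideal_of_hull)
qed

lemma ideal_power_mult:
  assumes I: "ideal_of (mpolys V) I"
    and a: "a \<in> ideal_power (mpolys V) I s" and b: "b \<in> ideal_power (mpolys V) I t"
  shows "a * b \<in> ideal_power (mpolys V) I (s + t)"
  using a
proof (induction s arbitrary: a)
  case 0
  then show ?case using ideal_power_ideal[OF I, of t] b by (simp add: ideal_of_def)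
next
  case (Suc s)
  let ?J = "ideal_power (mpolys V) I (Suc s + t)"
  have J: "ideal_of (mpolys V) ?J" by (rule ideal_power_ideal[OF I])
  have "ideal_of (mpolys V) hull {x * y |x y. x \<in> I \<and> y \<in> ideal_power (mpolys V) I s}
      \<subseteq> {a \<in> mpolys V. a * b \<in> ?J}"
  proof (rule hull_minimal)
    show "{x * y |x y. x \<in> I \<and> y \<in> ideal_power (mpolys V) I s} \<subseteq> {a \<in> mpolys V. a * b \<in> ?J}"
    proof clarify
      fix x y assume xy: "x \<in> I" "y \<in> ideal_power (mpolys V) I s"
      have "x * (y * b) \<in> {x * y |x y. x \<in> I \<and> y \<in> ideal_power (mpolys V) I (s + t)}"
        using xy Suc.IH by blast
      then have "x * (y * b) \<in> ?J" by (simp add: hull_inc)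
      moreover have "x * y \<in> mpolys V"
        using xy I ideal_power_ideal[OF I, of s] by (auto simp: ideal_of_def intro: mult_in_mpolys)
      ultimately show "x * y \<in> mpolys V \<and> x * y * b \<in> ?J" by (simp add: mult.assoc)
    qed
    show "ideal_of (mpolys V) {a \<in> mpolys V. a * b \<in> ?J}"
      using J by (simp add: ideal_of_def add_in_mpolys mult_in_mpolys distrib_right mult.assoc subset_iff)
  qed
  then show ?case using Suc.prems by auto
qed

lemma edge_ideal_ideal:
  assumes "simple_graph n E"
  shows "ideal_of (mpolys {1..n}) (edge_ideal n E :: (nat, 'k::field) mpoly set)"
  unfolding edge_ideal_def
  using edge_vertices[OF assms]
  by (intro ideal_of_hull) (force simp: edge_monomials_def intro!: mult_in_mpolys mvar_in_mpolys)

text \<open>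
  The Rees algebra is a subalgebra containing the generators, because \<open>I\<^sup>s I\<^sup>t \<subseteq> I\<^bsup>s+t\<^esup>\<close>.  Conversely let \<open>T\<close>
  be the algebra they generate.  The polynomials \<open>a\<close> whose multiple of the \<open>s\<close>-th power of the Rees
  variable lies in \<open>T\<close> form an ideal; it contains \<open>I\<close> for \<open>s = 1\<close>, and by induction \<open>I\<^sup>s\<close> in general.
\<close>
lemma rees_algebra_eq:
  assumes G: "simple_graph n E"
  shows "rees_algebra (mpolys {1..n}) (edge_ideal n E) =
    toric_map rees_const ` mpolys (rees_generators n E :: (nat, 'k::field) mpoly poly set)"
    (is "?R = ?A")
proof
  \<comment> \<open>keeps \<open>1\<close> in \<open>{1..n}\<close> and in the exponent of the Rees variable from turning into \<open>Suc 0\<close>\<close>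
  note One_nat_def [simp del]
  let ?S = "mpolys {1..n} :: (nat, 'k) mpoly set" and ?I = "edge_ideal n E :: (nat, 'k) mpoly set"
  note I = edge_ideal_ideal[OF G, where 'k = 'k]
  have A: "?A = subalgebra rees_const hull rees_generators n E"
    by (rule rees_const.subalgebra_hull_eq[symmetric])
  have coeff_constant: "coeff [:a:] s = (if s = 0 then a else 0)" for a :: "(nat, 'k) mpoly" and s
    by (simp add: coeff_pCons split: nat.split)
  have power_0: "0 \<in> ideal_power ?S ?I s" for s
    using ideal_power_ideal[OF I, of s] by (simp add: ideal_of_def)
  have power_add: "a + b \<in> ideal_power ?S ?I s" if "a \<in> ideal_power ?S ?I s" "b \<in> ideal_power ?S ?I s" for a b s
    using ideal_power_ideal[OF I, of s] that by (simp add: ideal_of_def)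
  have power_sum: "sum f X \<in> ideal_power ?S ?I s" if "\<And>x. x \<in> X \<Longrightarrow> f x \<in> ideal_power ?S ?I s" for f X s
    using that by (induction X rule: infinite_finite_induct) (auto intro: power_0 power_add)
  have edge_in_I: "e \<in> ?I" if "e \<in> edge_monomials E" for e
    using that by (simp add: edge_ideal_def hull_inc)
  show "?A \<subseteq> ?R"
    unfolding A
  proof (rule hull_minimal)
    show "rees_generators n E \<subseteq> ?R"
    proof
      fix u :: "(nat, 'k) mpoly poly" assume "u \<in> rees_generators n E"
      then consider i where "i \<in> {1..n}" "u = [:mvar i:]" | e where "e \<in> edge_monomials E" "u = monom e 1"
        by (auto simp: rees_generators_def)
      then show "u \<in> ?R"
      proof cases
        case 1
        then have "coeff u s \<in> ideal_power ?S ?I s" for s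
          using power_0[of s] by (simp add: coeff_constant mvar_in_mpolys)
        then show ?thesis by (simp add: rees_algebra_def)
      next
        case 2
        have "1 \<in> ideal_power ?S ?I 0" by simp
        with edge_in_I[OF 2(1)] have "e * 1 \<in> ideal_power ?S ?I (Suc 0)"
          unfolding ideal_power.simps(2) by (intro hull_inc) blast
        then have "e \<in> ideal_power ?S ?I 1" by (simp only: mult_1_right One_nat_def)
        then have "coeff u s \<in> ideal_power ?S ?I s" for s
          using power_0 2(2) by (cases "s = 1") simp_all
        then show ?thesis by (simp add: rees_algebra_def)
      qed
    qed
    show "subalgebra rees_const ?R"
      unfolding subalgebra_def
    proof (intro conjI ballI)
      have "coeff (rees_const c) s \<in> ideal_power ?S ?I s" for c s
        using power_0[of s]
        by (simp add: rees_const_def coeff_constant)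
      then show "range rees_const \<subseteq> ?R" by (auto simp: rees_algebra_def)
    next
      fix f g assume "f \<in> ?R" "g \<in> ?R"
      then have fg: "\<And>s. coeff f s \<in> ideal_power ?S ?I s" "\<And>s. coeff g s \<in> ideal_power ?S ?I s"
        by (simp_all add: rees_algebra_def)
      show "f + g \<in> ?R" using fg power_add by (simp add: rees_algebra_def)
      have "coeff f i * coeff g (s - i) \<in> ideal_power ?S ?I s" if "i \<le> s" for i s
        using ideal_power_mult[OF I fg(1)[of i] fg(2)[of "s - i"]] that by simp
      then show "f * g \<in> ?R" by (auto simp: rees_algebra_def coeff_mult intro!: power_sum)
    qed
  qed
  define T where "T = ?A"
  have "subalgebra rees_const T" unfolding T_def by (rule rees_const.toric_image_subalgebra)
  then have A_const: "rees_const c \<in> T"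
    and A_ring: "f \<in> T \<Longrightarrow> g \<in> T \<Longrightarrow> f + g \<in> T" "f \<in> T \<Longrightarrow> g \<in> T \<Longrightarrow> f * g \<in> T" for c f g
    unfolding subalgebra_def by blast+
  have A_gen: "u \<in> T" if "u \<in> rees_generators n E" for u
    unfolding T_def A by (rule hull_inc[OF that])
  have A_0: "0 \<in> T" using A_const[of 0] by simp
  have A_poly: "[:a:] \<in> T" if "a \<in> ?S" for a
  proof -
    have "a \<in> {a. [:a:] \<in> T}"
      using that
    proof (rule mpolys_closure)
      show "mvar i \<in> {a. [:a:] \<in> T}" if "i \<in> {1..n}" for i
        using A_gen[of "[:mvar i:]"] that by (simp add: rees_generators_def)
      show "mconst c \<in> {a. [:a:] \<in> T}" for c
        using A_const[of c] by (simp add: rees_const_def)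
      show "p + q \<in> {a. [:a:] \<in> T}" if "p \<in> {a. [:a:] \<in> T}" "q \<in> {a. [:a:] \<in> T}" for p q
        using A_ring(1)[of "[:p:]" "[:q:]"] that by simp
      show "p * q \<in> {a. [:a:] \<in> T}" if "p \<in> {a. [:a:] \<in> T}" "q \<in> {a. [:a:] \<in> T}" for p q
        using A_ring(2)[of "[:p:]" "[:q:]"] that by (simp add: mult.commute)
    qed
    then show ?thesis by simp
  qed
  have ideal: "ideal_of ?S {a \<in> ?S. monom a s \<in> T}" for s
  proof -
    have T_smult: "monom (p * q) s \<in> T" if "p \<in> ?S" "monom q s \<in> T" for p q
      using A_ring(2)[OF A_poly[OF that(1)] that(2)] by (simp add: smult_monom)
    show ?thesis
      using A_0 A_ring(1) T_smult
      by (auto simp: ideal_of_def add_in_mpolys mult_in_mpolys add_monom[symmetric])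
  qed
  have "?I \<subseteq> {a \<in> ?S. monom a 1 \<in> T}"
    unfolding edge_ideal_def
  proof (rule hull_minimal)
    show "ideal_of ?S {a \<in> ?S. monom a 1 \<in> T}" by (rule ideal)
    show "edge_monomials E \<subseteq> {a \<in> ?S. monom a 1 \<in> T}"
    proof
      fix e :: "(nat, 'k) mpoly" assume e: "e \<in> edge_monomials E"
      then have "monom e 1 \<in> rees_generators n E" by (simp add: rees_generators_def)
      then show "e \<in> {a \<in> ?S. monom a 1 \<in> T}"
        using A_gen edge_in_I[OF e] I by (auto simp: ideal_of_def)
    qed
  qed
  then have A_I: "monom a 1 \<in> T" if "a \<in> ?I" for a using that by blast
  have A_power: "ideal_power ?S ?I s \<subseteq> {a \<in> ?S. monom a s \<in> T}" for s
  proof (induction s)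
    case 0
    show ?case using A_poly by (auto simp: monom_0)
  next
    case (Suc s)
    have "monom (a * b) (Suc s) = monom a 1 * monom b s" for a b :: "(nat, 'k) mpoly"
      by (simp add: mult_monom One_nat_def)
    then have "{a * b |a b. a \<in> ?I \<and> b \<in> ideal_power ?S ?I s} \<subseteq> {a \<in> ?S. monom a (Suc s) \<in> T}"
      using A_I A_ring(2) Suc I by (auto simp: ideal_of_def intro!: mult_in_mpolys)
    then show ?case
      unfolding ideal_power.simps using ideal[of "Suc s"] by (rule hull_minimal)
  qed
  have "?R \<subseteq> T"
  proof
    fix f assume "f \<in> ?R"
    then have monomials: "monom (coeff f s) s \<in> T" for s
      using A_power by (auto simp: rees_algebra_def)
    have "(\<Sum>s\<in>X. monom (coeff f s) s) \<in> T" for X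
      by (induction X rule: infinite_finite_induct) (auto intro: A_0 A_ring(1) monomials)
    from this[of "{..degree f}"] show "f \<in> T" by (simp add: poly_as_sum_of_monoms)
  qed
  then show "?R \<subseteq> ?A" by (simp add: T_def)
qed

lemma rees_algebra_toric:
  assumes "simple_graph n E"
  shows "toric_algebra (rees_const :: 'k::field \<Rightarrow> (nat, 'k) mpoly poly) (rees_generators n E)
    (rees_algebra (mpolys {1..n}) (edge_ideal n E))"
proof
  show "rees_algebra (mpolys {1..n}) (edge_ideal n E) =
      toric_map rees_const ` mpolys (rees_generators n E :: (nat, 'k) mpoly poly set)"
    by (rule rees_algebra_eq[OF assms])
next
  fix p :: "((nat, 'k) mpoly poly, 'k) mpoly" and j
  assume "p \<in> mpolys (rees_generators n E)" "toric_map rees_const p = 0"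
  then show "toric_map rees_const (hom_part j p) = 0"
    by (intro poly_eqI poly_mapping_eqI) (simp add: coeff_toric_rees_hom_part)
qed

text \<open>
  The two substitutions: \<open>\<sigma>\<close> renames the variable of \<open>x\<^sub>i x\<^sub>j\<close> to that of \<open>x\<^sub>i x\<^sub>j T\<close>, and \<open>\<tau>\<close> reverses this
  renaming and sends the variables of the \<open>x\<^sub>i\<close> to \<open>0\<close>.
\<close>
lemma betti_rees_ge:
  assumes G: "simple_graph n E"
  shows "betti_edge_ring TYPE('k::field) E i j \<le> betti_rees TYPE('k) n E i j"
proof -
  \<comment> \<open>keeps \<open>1\<close> in \<open>{1..n}\<close> and in the exponent of the Rees variable from turning into \<open>Suc 0\<close>\<close>
  note One_nat_def [simp del]
  let ?U = "rees_generators n E :: (nat, 'k) mpoly poly set"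
  let ?U' = "edge_monomials E :: (nat, 'k) mpoly set"
  define \<sigma> :: "(nat, 'k) mpoly \<Rightarrow> ((nat, 'k) mpoly poly, 'k) mpoly" where "\<sigma> u = mvar (monom u 1)" for u
  define \<tau> :: "(nat, 'k) mpoly poly \<Rightarrow> ((nat, 'k) mpoly, 'k) mpoly"
    where "\<tau> u = (if coeff u 1 = 0 then 0 else mvar (coeff u 1))" for u
  define \<eta> where "\<eta> = eval_at mconst \<sigma>"
  define \<rho> where "\<rho> = eval_at mconst \<tau>"
  have \<eta>: "graded_hom ?U' ?U \<eta>"
    unfolding \<eta>_def by (rule graded_hom_eval_at)
      (auto simp: \<sigma>_def rees_generators_def intro: mvar_in_hom_mpolys)
  have \<rho>: "graded_hom ?U ?U' \<rho>"
    unfolding \<rho>_def by (rule graded_hom_eval_at)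
      (auto simp: \<tau>_def rees_generators_def coeff_pCons One_nat_def intro!: mvar_in_hom_mpolys)
  have edge_nonzero: "u \<noteq> 0" if "u \<in> ?U'" for u
    using edge_monomial[OF that] by (metis lookup_single_eq lookup_zero zero_neq_one)
  have retract: "\<rho> (\<eta> p) = p" if "p \<in> mpolys ?U'" for p
  proof -
    have "\<rho> (\<eta> p) = eval_at mconst (\<lambda>u. eval_at mconst \<tau> (\<sigma> u)) p"
      unfolding \<rho>_def \<eta>_def by (rule mconst.eval_at_comp)
    also have "\<dots> = eval_at mconst mvar p"
      using that by (rule eval_at_cong) (simp add: \<sigma>_def \<tau>_def edge_nonzero)
    finally show ?thesis by (simp add: eval_at_mvar_id)
  qed
  have toric_\<eta>: "toric_map rees_const (\<eta> p) = eval_at rees_const (\<lambda>u. monom u 1) p" for p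
    unfolding \<eta>_def toric_map_eq_eval_at by (simp add: rees_const.eval_at_comp \<sigma>_def)
  have toric_\<rho>: "toric_map mconst (\<rho> p) = eval_at mconst (\<lambda>u. coeff u 1) p" for p
  proof -
    have "eval_at mconst (\<lambda>u. u) (\<tau> u) = coeff u 1" for u by (simp add: \<tau>_def)
    then show ?thesis unfolding \<rho>_def toric_map_eq_eval_at by (simp add: mconst.eval_at_comp)
  qed
  have ker_\<eta>: "toric_map rees_const (\<eta> p) = 0" if "p \<in> mpolys ?U'" "toric_map mconst p = 0" for p
    unfolding toric_\<eta> using that
    by (intro poly_eqI poly_mapping_eqI) (simp add: coeff_toric_edge_lift)
  have ker_\<rho>: "toric_map mconst (\<rho> p) = 0" if "p \<in> mpolys ?U" "toric_map rees_const p = 0" for p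
    unfolding toric_\<rho> using that by (intro poly_mapping_eqI) (simp add: lookup_eval_rees_coeff)
  have "finite ?U'" by (rule finite_edge_monomials[OF G])
  moreover from this have "finite ?U" by (simp add: rees_generators_def)
  ultimately show ?thesis
    unfolding betti_edge_ring_def betti_rees_def
    by (intro betti_retract[OF rees_algebra_toric[OF G] _ edge_ring_toric _ \<eta> \<rho> retract ker_\<eta> ker_\<rho>])
qed

text \<open>
  For the regularity, every pair of indices with a nonzero Betti number of \<open>K[G]\<close> also occurs for
  \<open>R(I)\<close>, so the supremum for \<open>R(I)\<close> ranges over a larger set.
\<close>
theorem corollary1p4:
  fixes n :: nat and E :: "nat set set"
  assumes "simple_graph n E"
  shows "(\<forall>i j. betti_rees TYPE('k::field) n E i j \<ge> betti_edge_ring TYPE('k) E i j) \<and>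
         reg_rees TYPE('k) n E \<ge> reg_edge_ring TYPE('k) E"
proof
  show betti: "\<forall>i j. betti_rees TYPE('k) n E i j \<ge> betti_edge_ring TYPE('k) E i j"
    using betti_rees_ge[OF assms] by blast
  have "betti_rees TYPE('k) n E i j \<noteq> 0" if "betti_edge_ring TYPE('k) E i j \<noteq> 0" for i j
    using betti that by (metis le_zero_eq)
  then show "reg_rees TYPE('k) n E \<ge> reg_edge_ring TYPE('k) E"
    unfolding reg_rees_def reg_edge_ring_def regularity_def betti_rees_def betti_edge_ring_def
    by (intro Sup_subset_mono) blast
qed

end
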